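(* Let $\sigma\in C^2(\mathbb{R}^n;\mathbb{R}^{n\times m})$ and $u\in C^3(\mathbb{R}^n)$, and let $\bar x\in\mathbb{R}^n$ satisfy $\nabla u(\bar x)\ne0$ and $\nabla u(\bar x)\,\sigma(\bar x)=0$. Consider the symmetric system $\dot x_t=\sigma(x_t)a_t$ with controls valued in $B_1(0)=\{a\in\mathbb{R}^m:|a|\le1\}$, and a target $\mathcal T$ which in a neighborhood of $\bar x$ is given by $\mathcal T=\{x:u(x)\le u(\bar x)\}$. Let $T$ be the minimum time function. Then the following are equivalent: (a) there are $C,r>0$ such that $T(x)\le C|x-\bar x|^{1/2}$ for all $x\in B_r(\bar x)$; (b) the symmetric matrix $K(\bar x)$ has a negative eigenvalue; (c) with $f(x,a)=\sigma(x)a$ and $F_{a_1,a_2}(x)=\sigma(x)(a_1+a_2)$, $$\max_{a_1,a_2\in B_1(0)}\Big\{-\mathrm{Tr}\big(D^2u(\bar x)F_{a_1,a_2}(\bar x)\otimes F_{a_1,a_2}(\bar x)\big)-\big(DF_{a_1,a_2}(\bar x)F_{a_1,a_2}(\bar x)+[f(\cdot,a_1),f(\cdot,a_2)](\bar x)\big)\cdot\nabla u(\bar x)\Big\}>0.$$ Moreover, in this case there are $C,r>0$ such that $T(x)\le C\,d(x)^{1/2}$ for all $x\in B_r(\bar x)$, where $d(x)$ is the distance of $x$ from $\mathcal T$.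
   Context: Controls $a_\cdot:[0,+\infty)\to B_1(0)$ are piecewise constant (finitely many pieces on bounded intervals); trajectories are solutions of the system on their maximal interval of existence. Minimum time function: $T(x)=\inf_{a_\cdot}t_x(a_\cdot)$, $t_x(a_\cdot)=\inf\{t\ge0:x_t\in\mathcal T\}$ with $x_0=x$ ($\inf\emptyset=+\infty$). $B_r(x)$ is the closed ball. Here $\nabla u\,\sigma$ is the vector function with components $\nabla u\cdot\sigma_i$, $i=1,\dots,m$, with $\sigma_i$ the columns of $\sigma$. Define the $m\times m$ matrix $S(x)=D(\nabla u\,\sigma)(x)\,\sigma(x)$, that is $S_{i,j}(x)=\nabla(\nabla u\cdot\sigma_i)(x)\cdot\sigma_j(x)$; let $S^*=\frac12(S+{}^tS)$ be its symmetric part. Define the symmetric $2m\times2m$ matrix $$K(x)=\begin{pmatrix}S^*(x)&{}^tS(x)\\S(x)&S^*(x)\end{pmatrix}.$$ $Df=(\partial_{x_j}f_i)_{i,j}$ denotes the Jacobian, $[f,g]=Dg\,f-Df\,g$ the Lie bracket, $p\otimes q=p\,{}^tq$. *)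

theory Defs
  imports "HOL-Analysis.Analysis"
begin

primrec Ck :: "nat \<Rightarrow> ('a::euclidean_space \<Rightarrow> 'b::euclidean_space) \<Rightarrow> bool" where
  "Ck 0 f \<longleftrightarrow> continuous_on UNIV f"
| "Ck (Suc k) f \<longleftrightarrow>
     (\<forall>x. f differentiable at x) \<and> (\<forall>v. Ck k (\<lambda>x. frechet_derivative f (at x) v))"

definition grad :: "(real^'n \<Rightarrow> real) \<Rightarrow> real^'n \<Rightarrow> real^'n" where
  "grad u x = (\<chi> j. frechet_derivative u (at x) (axis j 1))"

definition hessian :: "(real^'n \<Rightarrow> real) \<Rightarrow> real^'n \<Rightarrow> real^'n^'n" where
  "hessian u x = jacobian (grad u) (at x)"

text \<open>Sign convention of the bracket: \<open>[f, g] = Dg f - Df g\<close>.\<close>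

definition lie_bracket :: "(real^'n \<Rightarrow> real^'n) \<Rightarrow> (real^'n \<Rightarrow> real^'n) \<Rightarrow> real^'n \<Rightarrow> real^'n" where
  "lie_bracket f g x = jacobian g (at x) *v f x - jacobian f (at x) *v g x"

definition outer :: "real^'n \<Rightarrow> real^'n \<Rightarrow> real^'n^'n" where
  "outer p q = (\<chi> i j. p $ i * q $ j)"

definition S_mat :: "(real^'n \<Rightarrow> real) \<Rightarrow> (real^'n \<Rightarrow> real^'m^'n) \<Rightarrow> real^'n \<Rightarrow> real^'m^'m" where
  "S_mat u \<sigma> x = jacobian (\<lambda>y. grad u y v* \<sigma> y) (at x) ** \<sigma> x"

definition sym_part :: "real^'m^'m \<Rightarrow> real^'m^'m" where
  "sym_part S = (1/2) *\<^sub>R (S + transpose S)"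

text \<open>The \<open>2m \<times> 2m\<close> block matrices are indexed by the disjoint sum \<open>'m + 'm\<close>.\<close>

definition block_mat ::
  "real^'m^'m \<Rightarrow> real^'m^'m \<Rightarrow> real^'m^'m \<Rightarrow> real^'m^'m \<Rightarrow> real^('m + 'm)^('m + 'm)" where
  "block_mat A B C D = (\<chi> p q.
     case p of
       Inl i \<Rightarrow> (case q of Inl j \<Rightarrow> A $ i $ j | Inr j \<Rightarrow> B $ i $ j)
     | Inr i \<Rightarrow> (case q of Inl j \<Rightarrow> C $ i $ j | Inr j \<Rightarrow> D $ i $ j))"

definition K_mat ::
  "(real^'n \<Rightarrow> real) \<Rightarrow> (real^'n \<Rightarrow> real^'m^'n) \<Rightarrow> real^'n \<Rightarrow> real^('m + 'm)^('m + 'm)" where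
  "K_mat u \<sigma> x =
     block_mat (sym_part (S_mat u \<sigma> x)) (transpose (S_mat u \<sigma> x))
               (S_mat u \<sigma> x)            (sym_part (S_mat u \<sigma> x))"

definition is_eigenvalue :: "real^'k^'k \<Rightarrow> real \<Rightarrow> bool" where
  "is_eigenvalue A l \<longleftrightarrow> (\<exists>v. v \<noteq> 0 \<and> A *v v = l *\<^sub>R v)"

text \<open>
  Only times \<open>t \<ge> 0\<close> matter.  A control may switch at the points of \<open>P\<close>,
  finitely many in each bounded interval; its values at those points are unrestricted.
\<close>

definition piecewise_constant :: "(real \<Rightarrow> 'b) \<Rightarrow> bool" where
  "piecewise_constant a \<longleftrightarrow>
     (\<exists>P. (\<forall>b. finite (P \<inter> {0..b})) \<and>
          (\<forall>s t. 0 \<le> s \<and> s \<le> t \<and> P \<inter> {s..t} = {} \<longrightarrow> a s = a t))"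

definition control :: "'b set \<Rightarrow> (real \<Rightarrow> 'b) \<Rightarrow> bool" where
  "control A a \<longleftrightarrow> piecewise_constant a \<and> (\<forall>t\<ge>0. a t \<in> A)"

text \<open>
  Solutions of \<open>x' = f(x, a)\<close>, \<open>x(0) = x0\<close> on \<open>[0, \<tau>)\<close> with \<open>0 < \<tau> \<le> \<infinity>\<close>: continuous, and
  satisfying the equation except at a set of times that is finite on bounded intervals
  (the control being discontinuous at its switching times).
\<close>

definition solution ::
  "('x::real_normed_vector \<Rightarrow> 'b \<Rightarrow> 'x) \<Rightarrow> (real \<Rightarrow> 'b) \<Rightarrow> 'x \<Rightarrow> ereal \<Rightarrow> (real \<Rightarrow> 'x) \<Rightarrow> bool" where
  "solution f a x0 \<tau> y \<longleftrightarrow>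
     0 < \<tau> \<and> y 0 = x0 \<and> continuous_on {t. 0 \<le> t \<and> ereal t < \<tau>} y \<and>
     (\<exists>P. (\<forall>b. finite (P \<inter> {0..b})) \<and>
          (\<forall>t. 0 < t \<and> ereal t < \<tau> \<and> t \<notin> P \<longrightarrow>
               (y has_vector_derivative f (y t) (a t)) (at t)))"

definition trajectory ::
  "('x::real_normed_vector \<Rightarrow> 'b \<Rightarrow> 'x) \<Rightarrow> (real \<Rightarrow> 'b) \<Rightarrow> 'x \<Rightarrow> ereal \<Rightarrow> (real \<Rightarrow> 'x) \<Rightarrow> bool" where
  "trajectory f a x0 \<tau> y \<longleftrightarrow>
     solution f a x0 \<tau> y \<and>
     (\<forall>\<tau>' z. \<tau> \<le> \<tau>' \<and> solution f a x0 \<tau>' z \<and> (\<forall>t. 0 \<le> t \<and> ereal t < \<tau> \<longrightarrow> z t = y t)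
        \<longrightarrow> \<tau>' = \<tau>)"

text \<open>
  For \<open>f\<close> locally Lipschitz in the state, as for \<open>f(x, a) = \<sigma>(x) a\<close> with \<open>\<sigma>\<close> of class
  \<open>C\<^sup>2\<close>, the maximal trajectory is unique on its interval, so the quantification over
  \<open>\<tau>\<close> and \<open>y\<close> just names it.  The infimum of the empty set is \<open>\<infinity>\<close>.
\<close>

definition hitting_time ::
  "('x::real_normed_vector \<Rightarrow> 'b \<Rightarrow> 'x) \<Rightarrow> 'x set \<Rightarrow> 'x \<Rightarrow> (real \<Rightarrow> 'b) \<Rightarrow> ereal" where
  "hitting_time f \<T> x a =
     Inf {ereal t | t. 0 \<le> t \<and> (\<exists>\<tau> y. trajectory f a x \<tau> y \<and> ereal t < \<tau> \<and> y t \<in> \<T>)}"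

definition minimum_time ::
  "('x::real_normed_vector \<Rightarrow> 'b \<Rightarrow> 'x) \<Rightarrow> 'b set \<Rightarrow> 'x set \<Rightarrow> 'x \<Rightarrow> ereal" where
  "minimum_time f A \<T> x = (INF a \<in> Collect (control A). hitting_time f \<T> x a)"

definition second_order_expr ::
  "(real^'n \<Rightarrow> real) \<Rightarrow> (real^'n \<Rightarrow> real^'m \<Rightarrow> real^'n) \<Rightarrow>
   (real^'m \<Rightarrow> real^'m \<Rightarrow> real^'n \<Rightarrow> real^'n) \<Rightarrow> real^'n \<Rightarrow> real^'m \<Rightarrow> real^'m \<Rightarrow> real" where
  "second_order_expr u f F x a1 a2 =
     - trace (hessian u x ** outer (F a1 a2 x) (F a1 a2 x))
     - (jacobian (F a1 a2) (at x) *v F a1 a2 x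
        + lie_bracket (\<lambda>y. f y a1) (\<lambda>y. f y a2) x) \<bullet> grad u x"

definition is_maximum :: "real \<Rightarrow> ('b \<Rightarrow> real) \<Rightarrow> 'b set \<Rightarrow> bool" where
  "is_maximum M g A \<longleftrightarrow> (\<exists>p\<in>A. g p = M) \<and> (\<forall>p\<in>A. g p \<le> M)"

end

theory Submission
  imports Defs
begin

text \<open>
  Write \<open>g = \<nabla>u \<sigma>\<close> and \<open>S = Dg \<sigma>\<close>. Along a trajectory with control \<open>a\<close> one has \<open>u' = g \<bullet> a\<close> and
  \<open>g' = S a\<close>. As \<open>g\<close> vanishes at the reference point, what can be gained in \<open>u\<close> is decided at second
  order. Using the control \<open>a\<close> and then the control \<open>b\<close>, each for a time \<open>t\<close>, changes \<open>u\<close> by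
  \<open>t g \<bullet> (a + b) + t\<^sup>2 Q(a, b) / 2 + o(t\<^sup>2)\<close> with \<open>Q(a, b) = a \<bullet> S a + b \<bullet> S b + 2 b \<bullet> S a\<close>, which is
  the constant \<open>two_step_form\<close>. All three conditions turn out to say that \<open>Q\<close> takes a negative value.

  Conditions (b) and (c) do so by algebra. The quadratic form of \<open>K\<close> is \<open>Q\<close>
  (\<open>K_mat_quadratic_form\<close>), and a symmetric matrix has a negative eigenvalue if and only if its form
  takes a negative value. The expression maximised in (c) is \<open>-Q\<close> (\<open>second_order_expr_eq\<close>), by
  symmetry of the Hessian of \<open>u\<close>.

  If \<open>Q(a, b) < 0\<close>, then from every point near the reference point two arcs of length \<open>t\<close>
  decrease \<open>u\<close> by at least \<open>k t\<^sup>2\<close> (\<open>two_arc_descent\<close>); the unknown sign of the first-order term is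
  dealt with by the symmetry \<open>Q(-a, -b) = Q(a, b)\<close>. Since \<open>u\<close> is locally Lipschitz, its excess over
  the value at the reference point is at most a multiple of the distance \<open>d\<close> to the target, and a time
  of order \<open>d\<^sup>1\<^sup>/\<^sup>2\<close> suffices to remove it. This gives the bound in terms of \<open>d\<close>
  (\<open>infdist_bound_of_negative_form\<close>), and (a) follows because the reference point is in the target.

  If \<open>Q\<close> is nonnegative, then \<open>S\<close> is symmetric and positive semidefinite
  (\<open>two_step_form_nonneg_imp\<close>). For an arbitrary control with integral \<open>A\<close>, symmetry turns the
  second-order term into \<open>A \<bullet> S A / 2\<close>, which is nonnegative (\<open>second_order_expansion\<close>). From a point
  at distance \<open>\<epsilon>\<close> in the direction of the gradient, a trajectory of duration \<open>O(\<epsilon>\<^sup>1\<^sup>/\<^sup>2)\<close> therefore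
  decreases \<open>u\<close> by \<open>o(\<epsilon>)\<close> only, while the excess to be removed is of order \<open>\<epsilon>\<close>. So (a) fails
  (\<open>no_holder_bound_of_nonneg_form\<close>).
\<close>


section \<open>Quadratic forms and negative eigenvalues\<close>

lemma linear_coeff_zero_if_quadratic_nonneg:
  fixes p q :: real
  assumes "\<And>t. 0 \<le> p * t\<^sup>2 + q * t"
  shows "q = 0"
proof (rule ccontr)
  assume "q \<noteq> 0"
  (* For t = - q / k the linear term, of size q^2 / k, exceeds the quadratic term, of size at most
     |p| q^2 / k^2, as soon as k > |p|. *)
  define k where "k = \<bar>p\<bar> + 1"
  have k: "k > 0" "p < k" unfolding k_def by linarith+
  have "p * (- q / k)\<^sup>2 + q * (- q / k) = (q\<^sup>2 / k) * (p / k - 1)"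
    using k by (simp add: field_simps power2_eq_square)
  also have "\<dots> < 0"
    using k \<open>q \<noteq> 0\<close> by (intro mult_pos_neg) (auto simp: field_simps)
  finally show False using assms[of "- q / k"] by linarith
qed

lemma inner_sym_mat:
  fixes A :: "real^'n^'n"
  assumes "transpose A = A"
  shows "v \<bullet> (A *v w) = w \<bullet> (A *v v)"
  by (metis assms dot_lmul_matrix inner_commute transpose_matrix_vector)

text \<open>
  A null vector of a positive semidefinite form is a minimiser of it, so the first-order term of
  the form at that vector vanishes in every direction, in particular in the direction \<open>A v\<close>.
\<close>

lemma psd_null_vector:
  fixes A :: "real^'n^'n"
  assumes sym: "transpose A = A"
    and psd: "\<And>w. 0 \<le> w \<bullet> (A *v w)"
    and null: "v \<bullet> (A *v v) = 0"
  shows "A *v v = 0"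
proof -
  define z where "z = A *v v"
  have "0 \<le> (z \<bullet> (A *v z)) * t\<^sup>2 + (2 * (z \<bullet> z)) * t" for t
  proof -
    have "(v + t *\<^sub>R z) \<bullet> (A *v (v + t *\<^sub>R z)) =
        v \<bullet> (A *v v) + t * (z \<bullet> (A *v v)) + t * (v \<bullet> (A *v z)) + t\<^sup>2 * (z \<bullet> (A *v z))"
      by (simp add: matrix_vector_right_distrib matrix_vector_mult_scaleR inner_add_left
          inner_add_right power2_eq_square algebra_simps)
    also have "\<dots> = (z \<bullet> (A *v z)) * t\<^sup>2 + (2 * (z \<bullet> z)) * t"
      using null inner_sym_mat[OF sym, of v z] by (simp add: z_def)
    finally show ?thesis using psd[of "v + t *\<^sub>R z"] by simp
  qed
  then have "2 * (z \<bullet> z) = 0" by (rule linear_coeff_zero_if_quadratic_nonneg)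
  then show ?thesis by (simp add: z_def)
qed

text \<open>
  Minimise the Rayleigh quotient on the unit sphere: if the minimum \<open>R\<close> is attained at \<open>v\<close>, then
  \<open>A - R\<close> is positive semidefinite with null vector \<open>v\<close>, so \<open>v\<close> is an eigenvector for \<open>R\<close>.
\<close>

lemma negative_eigenvalue_iff:
  fixes A :: "real^'k^'k"
  assumes sym: "transpose A = A"
  shows "(\<exists>l<0. is_eigenvalue A l) \<longleftrightarrow> (\<exists>v. v \<bullet> (A *v v) < 0)"
proof
  assume "\<exists>l<0. is_eigenvalue A l"
  then obtain l v where "l < 0" "v \<noteq> 0" "A *v v = l *\<^sub>R v"
    unfolding is_eigenvalue_def by blast
  then have "v \<bullet> (A *v v) < 0" by (simp add: mult_neg_pos)
  then show "\<exists>v. v \<bullet> (A *v v) < 0" ..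
next
  assume "\<exists>v. v \<bullet> (A *v v) < 0"
  then obtain v0 where v0: "v0 \<bullet> (A *v v0) < 0" ..
  define R where "R = (\<lambda>v. v \<bullet> (A *v v))"
  have scale: "R (c *\<^sub>R v) = c\<^sup>2 * R v" for c v
    by (simp add: R_def matrix_vector_mult_scaleR power2_eq_square)
  have "continuous_on (sphere 0 1) R"
    unfolding R_def by (intro continuous_intros)
  moreover have "sphere (0::real^'k) 1 \<noteq> {}" by simp
  ultimately obtain v where v: "norm v = 1" and min: "\<And>w. norm w = 1 \<Longrightarrow> R v \<le> R w"
    using continuous_attains_inf[of "sphere 0 1" R] by auto
  have vv: "v \<bullet> v = 1" using v by (simp add: norm_eq_1)
  have ray: "R v * (w \<bullet> w) \<le> R w" for w
  proof (cases "w = 0")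
    case False
    have "R v \<le> R ((1 / norm w) *\<^sub>R w)" using False by (intro min) simp
    then show ?thesis unfolding scale using False
      by (simp add: field_simps power2_norm_eq_inner)
  qed (simp add: R_def)
  define B where "B = A - R v *\<^sub>R mat 1"
  have Bw: "B *v w = A *v w - R v *\<^sub>R w" for w
    by (simp add: B_def matrix_vector_mult_diff_rdistrib scaleR_matrix_vector_assoc[symmetric])
  have "transpose B = B"
    using sym by (simp add: B_def transpose_def vec_eq_iff mat_def)
  moreover have "0 \<le> w \<bullet> (B *v w)" for w
    using ray[of w] by (simp add: Bw inner_diff_right R_def)
  moreover have "v \<bullet> (B *v v) = 0"
    using vv by (simp add: Bw inner_diff_right R_def)
  ultimately have "B *v v = 0" by (rule psd_null_vector)
  then have "A *v v = R v *\<^sub>R v" by (simp add: Bw)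
  moreover have "R v < 0"
  proof -
    have "R v * (v0 \<bullet> v0) < 0" using ray[of v0] v0 unfolding R_def by linarith
    then show ?thesis by (metis inner_ge_zero mult_less_0_iff not_less)
  qed
  moreover have "v \<noteq> 0" using v by auto
  ultimately show "\<exists>l<0. is_eigenvalue A l" unfolding is_eigenvalue_def by blast
qed

text \<open>
  Twice the \<open>t\<^sup>2\<close> coefficient of the change of \<open>u\<close> when the control \<open>a\<close> and then the control \<open>b\<close>
  are each applied for a time \<open>t\<close>, with \<open>S\<close> the matrix \<open>D(\<nabla>u \<sigma>) \<sigma>\<close> of the system.
  The cross term records that the first arc moves \<open>\<nabla>u \<sigma>\<close> by \<open>t S a\<close> before the second one starts.
\<close>

definition two_step_form :: "real^'m^'m \<Rightarrow> real^'m \<Rightarrow> real^'m \<Rightarrow> real" where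
  "two_step_form S a b = a \<bullet> (S *v a) + b \<bullet> (S *v b) + 2 * (b \<bullet> (S *v a))"

lemma two_step_form_scaleR: "two_step_form S (c *\<^sub>R a) (c *\<^sub>R b) = c\<^sup>2 * two_step_form S a b"
  by (simp add: two_step_form_def matrix_vector_mult_scaleR power2_eq_square algebra_simps)

text \<open>
  The form vanishes on the pairs \<open>(a, -a)\<close>. If it is nonnegative, these are minimisers, and
  stationarity there says that \<open>S\<close> is symmetric; positivity of \<open>S\<close> is then read off from \<open>b = 0\<close>.
\<close>

lemma two_step_form_nonneg_imp:
  fixes S :: "real^'m^'m"
  assumes "\<And>a b. 0 \<le> two_step_form S a b"
  shows "b \<bullet> (S *v a) = a \<bullet> (S *v b)" "0 \<le> a \<bullet> (S *v a)"
proof -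
  have "0 \<le> (b \<bullet> (S *v b)) * t\<^sup>2 + (b \<bullet> (S *v a) - a \<bullet> (S *v b)) * t" for t
  proof -
    have "two_step_form S (a + t *\<^sub>R b) (- a) =
        (b \<bullet> (S *v b)) * t\<^sup>2 + (b \<bullet> (S *v a) - a \<bullet> (S *v b)) * t"
      unfolding two_step_form_def
      by (simp add: linear_neg[OF matrix_vector_mul_linear] matrix_vector_right_distrib matrix_vector_mult_scaleR inner_add_left
          inner_add_right power2_eq_square algebra_simps)
    then show ?thesis using assms by metis
  qed
  then show "b \<bullet> (S *v a) = a \<bullet> (S *v b)"
    using linear_coeff_zero_if_quadratic_nonneg by force
  show "0 \<le> a \<bullet> (S *v a)" using assms[of a 0] by (simp add: two_step_form_def)
qed

lemma sum_over_sum_type: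
  fixes h :: "'a::finite + 'b::finite \<Rightarrow> 'c::comm_monoid_add"
  shows "(\<Sum>p\<in>UNIV. h p) = (\<Sum>i\<in>UNIV. h (Inl i)) + (\<Sum>i\<in>UNIV. h (Inr i))"
proof -
  have "(\<Sum>p\<in>UNIV. h p) = sum h (UNIV <+> UNIV)" by (simp add: UNIV_Plus_UNIV)
  also have "\<dots> = (\<Sum>i\<in>UNIV. h (Inl i)) + (\<Sum>i\<in>UNIV. h (Inr i))"
    by (subst sum.Plus) (auto simp: comp_def)
  finally show ?thesis .
qed

text \<open>
  The link between condition (b) and the dynamics: the two blocks of a vector are the controls
  used on the two arcs.
\<close>

lemma K_mat_quadratic_form:
  fixes v :: "real^('m::finite + 'm)"
  shows "v \<bullet> (K_mat u \<sigma> x *v v) =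
     two_step_form (S_mat u \<sigma> x) (\<chi> i. v $ Inl i) (\<chi> i. v $ Inr i)"
proof -
  define a b S where "a = (\<chi> i. v $ Inl i)" and "b = (\<chi> i. v $ Inr i)" and "S = S_mat u \<sigma> x"
  have top: "(K_mat u \<sigma> x *v v) $ Inl i = (sym_part S *v a + transpose S *v b) $ i"
    and bot: "(K_mat u \<sigma> x *v v) $ Inr i = (S *v a + sym_part S *v b) $ i" for i
    by (simp_all add: matrix_vector_mult_def sum_over_sum_type K_mat_def block_mat_def a_def b_def S_def
        del: transpose_matrix_vector)
  have "v \<bullet> (K_mat u \<sigma> x *v v) =
      a \<bullet> (sym_part S *v a + transpose S *v b) + b \<bullet> (S *v a + sym_part S *v b)"
    unfolding inner_vec_def sum_over_sum_type top bot by (simp add: a_def b_def)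
  also have "\<dots> = two_step_form S a b"
  proof -
    have t: "c \<bullet> (transpose S *v d) = d \<bullet> (S *v c)" for c d
      by (metis dot_lmul_matrix inner_commute transpose_matrix_vector)
    have s: "c \<bullet> (sym_part S *v c) = c \<bullet> (S *v c)" for c
      unfolding sym_part_def scaleR_matrix_vector_assoc[symmetric] matrix_vector_mult_add_rdistrib
        inner_scaleR_right inner_add_right t by simp
    show ?thesis by (simp only: s t inner_add_right two_step_form_def)
  qed
  finally show ?thesis by (simp add: a_def b_def S_def)
qed

lemma K_mat_symmetric: "transpose (K_mat u \<sigma> x) = K_mat u \<sigma> x"
  by (auto simp: vec_eq_iff transpose_def K_mat_def block_mat_def sym_part_def split: sum.split)

lemma K_mat_negative_eigenvalue_iff:
  "(\<exists>l<0. is_eigenvalue (K_mat u \<sigma> x) l) \<longleftrightarrow> (\<exists>a b. two_step_form (S_mat u \<sigma> x) a b < 0)"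
proof -
  have "\<exists>v. v \<bullet> (K_mat u \<sigma> x *v v) < 0" if "two_step_form (S_mat u \<sigma> x) a b < 0" for a b
  proof
    define v where "v = (\<chi> p. case p of Inl i \<Rightarrow> a $ i | Inr i \<Rightarrow> b $ i)"
    have "(\<chi> i. v $ Inl i) = a" "(\<chi> i. v $ Inr i) = b" by (simp_all add: v_def vec_eq_iff)
    then show "v \<bullet> (K_mat u \<sigma> x *v v) < 0" using that by (simp add: K_mat_quadratic_form)
  qed
  then show ?thesis
    unfolding negative_eigenvalue_iff[OF K_mat_symmetric] by (metis K_mat_quadratic_form)
qed


section \<open>Second-order calculus along the system\<close>

lemma Ck_SucD:
  assumes "Ck (Suc k) f"
  shows "(f has_derivative frechet_derivative f (at x)) (at x)"
    and "Ck k (\<lambda>x. frechet_derivative f (at x) v)"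
  using assms by (simp_all add: frechet_derivative_works[symmetric])

lemma Ck_imp_continuous: "Ck k f \<Longrightarrow> continuous_on UNIV f"
  by (cases k) (auto intro!: differentiable_imp_continuous_on simp: differentiable_on_def differentiable_at_withinI)

lemma Ck_Suc_imp_Ck: "Ck (Suc k) f \<Longrightarrow> Ck k f"
proof (induction k arbitrary: f)
  case 0
  then show ?case using Ck_imp_continuous[of 1 f] by simp
next
  case (Suc k)
  then show ?case by (metis Ck.simps(2))
qed

lemma linear_eq_sum_Basis:
  fixes L :: "'a::euclidean_space \<Rightarrow> 'b::real_vector"
  assumes "linear L"
  shows "L v = (\<Sum>b\<in>Basis. (v \<bullet> b) *\<^sub>R L b)"
proof -
  have "L v = L (\<Sum>b\<in>Basis. (v \<bullet> b) *\<^sub>R b)" by (simp add: euclidean_representation)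
  then show ?thesis using assms by (simp add: linear_sum linear_cmul)
qed

lemma norm_linear_le_sum_Basis:
  fixes L :: "'a::euclidean_space \<Rightarrow> 'b::real_normed_vector"
  assumes "linear L"
  shows "norm (L v) \<le> norm v * (\<Sum>b\<in>Basis. norm (L b))"
proof -
  have "norm (L v) \<le> (\<Sum>b\<in>Basis. norm ((v \<bullet> b) *\<^sub>R L b))"
    unfolding linear_eq_sum_Basis[OF assms, of v] by (rule norm_sum)
  also have "\<dots> = (\<Sum>b\<in>Basis. \<bar>v \<bullet> b\<bar> * norm (L b))" by simp
  also have "\<dots> \<le> (\<Sum>b\<in>Basis. norm v * norm (L b))"
    by (intro sum_mono mult_right_mono) (auto simp: Basis_le_norm)
  finally show ?thesis by (simp add: sum_distrib_left)
qed

text \<open>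
  In finite dimension, pointwise continuity of a family of linear maps is continuity of the
  finitely many images of the basis, hence joint continuity.
\<close>

lemma continuous_on_linear_family:
  fixes L :: "'c::topological_space \<Rightarrow> 'a::euclidean_space \<Rightarrow> 'b::real_normed_vector"
  assumes lin: "\<And>x. linear (L x)"
    and cont: "\<And>v. continuous_on S (\<lambda>x. L x v)"
    and k: "continuous_on S k"
  shows "continuous_on S (\<lambda>x. L x (k x))"
proof -
  have "L x (k x) = (\<Sum>b\<in>Basis. (k x \<bullet> b) *\<^sub>R L x b)" for x
    using lin by (rule linear_eq_sum_Basis)
  then show ?thesis by (simp only:) (intro continuous_intros cont k)
qed

lemma C1_lipschitz_on_cball:
  fixes f :: "'a::euclidean_space \<Rightarrow> 'b::euclidean_space"
  assumes "Ck 1 f"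
  obtains L where "0 \<le> L" "\<And>x y. x \<in> cball c r \<Longrightarrow> y \<in> cball c r \<Longrightarrow> norm (f x - f y) \<le> L * norm (x - y)"
proof -
  have f: "Ck (Suc 0) f" using assms by simp
  define N where "N = (\<lambda>x. \<Sum>b\<in>Basis. norm (frechet_derivative f (at x) b))"
  have "continuous_on (cball c r) N"
    unfolding N_def using Ck_SucD(2)[OF f]
    by (intro continuous_intros) (auto intro: continuous_on_subset)
  then have "bounded (N ` cball c r)"
    by (intro compact_imp_bounded compact_continuous_image) auto
  then obtain L where L: "0 < L" "\<And>x. x \<in> cball c r \<Longrightarrow> \<bar>N x\<bar> \<le> L"
    unfolding bounded_pos by auto
  have "norm (f x - f y) \<le> L * norm (x - y)" if "x \<in> cball c r" "y \<in> cball c r" for x y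
  proof (rule differentiable_bound[OF convex_cball _ _ that])
    fix z assume z: "z \<in> cball c r"
    show "(f has_derivative frechet_derivative f (at z)) (at z within cball c r)"
      using Ck_SucD(1)[OF f] has_derivative_at_withinI by blast
    have "linear (frechet_derivative f (at z))"
      using Ck_SucD(1)[OF f] has_derivative_linear by blast
    from norm_linear_le_sum_Basis[OF this] show "onorm (frechet_derivative f (at z)) \<le> L"
    proof (intro onorm_le)
      fix v
      have "norm (frechet_derivative f (at z) v) \<le> norm v * N z"
        unfolding N_def by fact
      also have "\<dots> \<le> norm v * L" using L(2)[OF z] by (intro mult_left_mono) auto
      finally show "norm (frechet_derivative f (at z) v) \<le> L * norm v" by (simp add: mult.commute)
    qed
  qed
  then show ?thesis using that L(1) less_imp_le by blast
qed

text \<open>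
  The mixed second difference is symmetric in \<open>v\<close> and \<open>w\<close>, while applying the mean value theorem
  first along \<open>v\<close> and then along \<open>w\<close> produces the second derivative taken in this order. This is
  the core of the symmetry of second derivatives.
\<close>

lemma second_difference_mean_value:
  fixes u :: "'a::euclidean_space \<Rightarrow> real"
  assumes u: "Ck 2 u" and h: "0 < h"
  obtains s r where "0 < s" "s < h" "0 < r" "r < h"
    "u (x + h *\<^sub>R v + h *\<^sub>R w) - u (x + h *\<^sub>R v) - u (x + h *\<^sub>R w) + u x =
     h\<^sup>2 * frechet_derivative (\<lambda>y. frechet_derivative u (at y) v) (at (x + s *\<^sub>R v + r *\<^sub>R w)) w"
proof -
  have u2: "Ck (Suc (Suc 0)) u" using u by (simp add: numeral_2_eq_2)
  note D1 = Ck_SucD(1)[OF u2] and D2 = Ck_SucD(1)[OF Ck_SucD(2)[OF u2]]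
  define Du where "Du = (\<lambda>y. frechet_derivative u (at y))"
  define D2u where "D2u = (\<lambda>y. frechet_derivative (\<lambda>y. Du y v) (at y))"
  have along: "((\<lambda>s. F (p + s *\<^sub>R q)) has_real_derivative F' (p + s *\<^sub>R q) q) (at s)"
    if "\<And>y. (F has_derivative F' y) (at y)" for F :: "'a \<Rightarrow> real" and F' p q s
  proof -
    have "((\<lambda>s. F (p + s *\<^sub>R q)) has_derivative (\<lambda>ds. F' (p + s *\<^sub>R q) (ds *\<^sub>R q))) (at s)"
      by (rule has_derivative_compose[OF _ that, where f = "\<lambda>s. p + s *\<^sub>R q"])
        (auto intro!: derivative_eq_intros)
    moreover have "F' (p + s *\<^sub>R q) (ds *\<^sub>R q) = F' (p + s *\<^sub>R q) q * ds" for ds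
      using linear_cmul[OF has_derivative_linear[OF that]] by simp
    ultimately show ?thesis by (simp add: has_field_derivative_def)
  qed
  define \<phi> where "\<phi> = (\<lambda>s. u ((x + h *\<^sub>R w) + s *\<^sub>R v) - u (x + s *\<^sub>R v))"
  have "DERIV \<phi> s :> Du ((x + h *\<^sub>R w) + s *\<^sub>R v) v - Du (x + s *\<^sub>R v) v" for s
    unfolding \<phi>_def Du_def by (intro DERIV_diff along D1)
  then obtain s where s: "0 < s" "s < h"
    and \<phi>: "\<phi> h - \<phi> 0 = h * (Du ((x + h *\<^sub>R w) + s *\<^sub>R v) v - Du (x + s *\<^sub>R v) v)"
    using MVT2[OF h, of \<phi> "\<lambda>s. Du ((x + h *\<^sub>R w) + s *\<^sub>R v) v - Du (x + s *\<^sub>R v) v"] by auto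
  define \<psi> where "\<psi> = (\<lambda>r. Du ((x + s *\<^sub>R v) + r *\<^sub>R w) v)"
  have "DERIV \<psi> r :> D2u ((x + s *\<^sub>R v) + r *\<^sub>R w) w" for r
    unfolding \<psi>_def Du_def D2u_def by (rule along[OF D2])
  then obtain r where r: "0 < r" "r < h"
    and \<psi>: "\<psi> h - \<psi> 0 = h * D2u ((x + s *\<^sub>R v) + r *\<^sub>R w) w"
    using MVT2[OF h, of \<psi> "\<lambda>r. D2u ((x + s *\<^sub>R v) + r *\<^sub>R w) w"] by auto
  have "\<phi> h - \<phi> 0 = h * (\<psi> h - \<psi> 0)"
    unfolding \<phi> \<psi>_def by (simp add: algebra_simps)
  then have "u (x + h *\<^sub>R v + h *\<^sub>R w) - u (x + h *\<^sub>R v) - u (x + h *\<^sub>R w) + u x =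
      h\<^sup>2 * D2u (x + s *\<^sub>R v + r *\<^sub>R w) w"
    unfolding \<psi> by (simp add: \<phi>_def power2_eq_square algebra_simps)
  then show ?thesis using that s r by (simp add: D2u_def Du_def)
qed

lemma second_derivative_symmetric:
  fixes u :: "'a::euclidean_space \<Rightarrow> real"
  assumes u: "Ck 2 u"
  shows "frechet_derivative (\<lambda>y. frechet_derivative u (at y) v) (at x) w =
         frechet_derivative (\<lambda>y. frechet_derivative u (at y) w) (at x) v"
proof -
  define \<Phi> where "\<Phi> = (\<lambda>v w z. frechet_derivative (\<lambda>y. frechet_derivative u (at y) v) (at z) w)"
  have u2: "Ck (Suc (Suc 0)) u" using u by (simp add: numeral_2_eq_2)
  have cont: "isCont (\<Phi> v w) x" for v w
    using Ck_SucD(2)[OF Ck_SucD(2)[OF u2]]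
    by (auto simp: \<Phi>_def continuous_on_eq_continuous_at)
  have "dist (\<Phi> v w x) (\<Phi> w v x) \<le> e" if e: "e > 0" for e
  proof -
    obtain d1 where d1: "d1 > 0" "\<And>z. dist z x < d1 \<Longrightarrow> dist (\<Phi> v w z) (\<Phi> v w x) < e / 2"
      using cont[of v w, unfolded continuous_at_eps_delta, rule_format, OF half_gt_zero[OF e]]
      by blast
    obtain d2 where d2: "d2 > 0" "\<And>z. dist z x < d2 \<Longrightarrow> dist (\<Phi> w v z) (\<Phi> w v x) < e / 2"
      using cont[of w v, unfolded continuous_at_eps_delta, rule_format, OF half_gt_zero[OF e]]
      by blast
    define N where "N = norm v + norm w + 1"
    have N: "N > 0" by (simp add: N_def add_nonneg_pos)
    define h where "h = min d1 d2 / (2 * N)"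
    have h: "h > 0" "h * N < min d1 d2"
    proof -
      have m: "min d1 d2 > 0" using d1(1) d2(1) by simp
      then show "h > 0" using N by (simp add: h_def)
      have "h * N = min d1 d2 / 2" using N by (simp add: h_def)
      then show "h * N < min d1 d2" using m by linarith
    qed
    have near: "dist (x + s *\<^sub>R a + r *\<^sub>R b) x < min d1 d2"
      if "0 < s" "s < h" "0 < r" "r < h" "norm a + norm b + 1 = N" for s r a b
    proof -
      have "dist (x + s *\<^sub>R a + r *\<^sub>R b) x \<le> s * norm a + r * norm b"
        using that(1,3) norm_triangle_ineq[of "s *\<^sub>R a" "r *\<^sub>R b"]
        by (simp add: dist_norm add.assoc)
      also have "\<dots> \<le> h * norm a + h * norm b"
        using that by (intro add_mono mult_right_mono) auto
      also have "\<dots> \<le> h * N"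
        unfolding that(5)[symmetric] using h(1) by (simp add: distrib_left)
      finally show ?thesis using h(2) by linarith
    qed
    obtain s r where 1: "0 < s" "s < h" "0 < r" "r < h"
      "u (x + h *\<^sub>R v + h *\<^sub>R w) - u (x + h *\<^sub>R v) - u (x + h *\<^sub>R w) + u x =
       h\<^sup>2 * \<Phi> v w (x + s *\<^sub>R v + r *\<^sub>R w)"
      using second_difference_mean_value[OF u h(1), of x v w] unfolding \<Phi>_def by blast
    obtain s' r' where 2: "0 < s'" "s' < h" "0 < r'" "r' < h"
      "u (x + h *\<^sub>R w + h *\<^sub>R v) - u (x + h *\<^sub>R w) - u (x + h *\<^sub>R v) + u x =
       h\<^sup>2 * \<Phi> w v (x + s' *\<^sub>R w + r' *\<^sub>R v)"
      using second_difference_mean_value[OF u h(1), of x w v] unfolding \<Phi>_def by blast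
    have "h\<^sup>2 * \<Phi> v w (x + s *\<^sub>R v + r *\<^sub>R w) = h\<^sup>2 * \<Phi> w v (x + s' *\<^sub>R w + r' *\<^sub>R v)"
      unfolding 1(5)[symmetric] 2(5)[symmetric] by (simp add: add.assoc add.commute add.left_commute)
    then have "\<Phi> v w (x + s *\<^sub>R v + r *\<^sub>R w) = \<Phi> w v (x + s' *\<^sub>R w + r' *\<^sub>R v)"
      using h(1) by simp
    moreover have "dist (\<Phi> v w (x + s *\<^sub>R v + r *\<^sub>R w)) (\<Phi> v w x) < e / 2"
      using near[OF 1(1-4), of v w] by (intro d1(2)) (simp add: N_def)
    moreover have "dist (\<Phi> w v (x + s' *\<^sub>R w + r' *\<^sub>R v)) (\<Phi> w v x) < e / 2"
      using near[OF 2(1-4), of w v] by (intro d2(2)) (simp add: N_def add.commute)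
    ultimately show ?thesis unfolding dist_real_def by linarith
  qed
  then have "dist (\<Phi> v w x) (\<Phi> w v x) \<le> 0" using field_le_epsilon[of _ 0] by force
  then show ?thesis by (simp add: \<Phi>_def)
qed

lemma bounded_bilinear_matrix_vector_mult:
  "bounded_bilinear ((*v) :: real^'m^'n \<Rightarrow> real^'m \<Rightarrow> real^'n)"
  unfolding bilinear_conv_bounded_bilinear[symmetric] bilinear_def
  by (auto intro!: linearI simp: matrix_vector_right_distrib matrix_vector_mult_add_rdistrib
      matrix_vector_mult_scaleR scaleR_matrix_vector_assoc)

lemma bounded_bilinear_vector_matrix_mult:
  "bounded_bilinear ((v*) :: real^'n \<Rightarrow> real^'m^'n \<Rightarrow> real^'m)"
  unfolding bilinear_conv_bounded_bilinear[symmetric] bilinear_def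
  by (auto intro!: linearI simp: vector_matrix_left_distrib vector_matrix_mult_add_rdistrib
      scaleR_vector_matrix_assoc vec_eq_iff vector_matrix_mult_def sum_distrib_left sum.distrib distrib_left distrib_right mult_ac)

lemma grad_inner:
  assumes "u differentiable at x"
  shows "grad u x \<bullet> v = frechet_derivative u (at x) v"
proof -
  have lin: "linear (frechet_derivative u (at x))"
    using assms by (rule linear_frechet_derivative)
  have "frechet_derivative u (at x) v = frechet_derivative u (at x) (\<Sum>i\<in>UNIV. v $ i *\<^sub>R axis i 1)"
    using basis_expansion[of v] by (simp add: scalar_mult_eq_scaleR)
  also have "\<dots> = (\<Sum>i\<in>UNIV. v $ i * frechet_derivative u (at x) (axis i 1))"
    using lin by (simp add: linear_sum linear_cmul)
  finally show ?thesis by (simp add: grad_def inner_vec_def mult.commute)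
qed

lemma trace_mult_outer: "trace (H ** outer p q) = (H *v p) \<bullet> q" for H :: "real^'k^'k"
  by (simp add: trace_def outer_def matrix_matrix_mult_def matrix_vector_mult_def inner_vec_def
      sum_distrib_right mult.assoc)

text \<open>
  The system \<open>x' = \<sigma>(x) a\<close> together with the function \<open>u\<close> to be decreased along it.
\<close>

locale symmetric_system =
  fixes \<sigma> :: "real^'n \<Rightarrow> real^'m^'n" and u :: "real^'n \<Rightarrow> real"
  assumes \<sigma>_C2: "Ck 2 \<sigma>" and u_C3: "Ck 3 u"
begin

abbreviation D\<sigma> where "D\<sigma> x \<equiv> frechet_derivative \<sigma> (at x)"

text \<open>
  The row \<open>\<nabla>u \<sigma>\<close>: along a trajectory with control \<open>a\<close>, the derivative of \<open>u\<close> is \<open>g \<bullet> a\<close>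
  and the derivative of \<open>g\<close> is \<open>S a\<close>.
\<close>

definition g :: "real^'n \<Rightarrow> real^'m" where "g x = grad u x v* \<sigma> x"

definition Dg :: "real^'n \<Rightarrow> real^'n \<Rightarrow> real^'m" where
  "Dg x v = (hessian u x *v v) v* \<sigma> x + grad u x v* D\<sigma> x v"

lemma \<sigma>_has_derivative: "(\<sigma> has_derivative D\<sigma> x) (at x)"
  and continuous_D\<sigma>: "continuous_on S (\<lambda>x. D\<sigma> x v)"
  and continuous_\<sigma>: "continuous_on S \<sigma>"
proof -
  have s: "Ck (Suc (Suc 0)) \<sigma>" using \<sigma>_C2 by (simp add: numeral_2_eq_2)
  show "(\<sigma> has_derivative D\<sigma> x) (at x)" by (rule Ck_SucD(1)[OF s])
  show "continuous_on S (\<lambda>x. D\<sigma> x v)"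
    using Ck_imp_continuous[OF Ck_SucD(2)[OF s]] continuous_on_subset by blast
  show "continuous_on S \<sigma>" using Ck_imp_continuous[OF s] continuous_on_subset by blast
qed

lemma u_C: "Ck (Suc (Suc (Suc 0))) u"
  using u_C3 by (simp add: numeral_3_eq_3)

lemma grad_eq: "grad u x \<bullet> v = frechet_derivative u (at x) v"
  using u_C by (intro grad_inner) simp

lemma u_has_derivative: "(u has_derivative (\<lambda>v. grad u x \<bullet> v)) (at x)"
  unfolding grad_eq by (rule Ck_SucD(1)[OF u_C])

lemma grad_has_derivative: "(grad u has_derivative (*v) (hessian u x)) (at x)"
proof -
  have "(\<lambda>y. grad u y \<bullet> b) differentiable at x" for b
    using Ck_SucD(2)[OF u_C, of b] by (simp add: grad_eq)
  then have "grad u differentiable at x" by (subst differentiable_componentwise_within) blast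
  then show ?thesis unfolding hessian_def by (rule jacobian_works[THEN iffD1])
qed

lemma hessian_inner:
  "(hessian u x *v v) \<bullet> w = frechet_derivative (\<lambda>y. frechet_derivative u (at y) w) (at x) v"
proof -
  have "((\<lambda>y. grad u y \<bullet> w) has_derivative (\<lambda>v. (hessian u x *v v) \<bullet> w)) (at x)"
    by (intro has_derivative_inner_left grad_has_derivative)
  then show ?thesis
    unfolding grad_eq by (rule frechet_derivative_at[THEN fun_cong])
qed

lemma hessian_symmetric: "(hessian u x *v v) \<bullet> w = (hessian u x *v w) \<bullet> v"
proof -
  have "Ck 2 u" using Ck_Suc_imp_Ck[OF u_C] by (simp add: numeral_2_eq_2)
  from second_derivative_symmetric[OF this] show ?thesis by (simp add: hessian_inner)
qed

lemma continuous_grad: "continuous_on S (grad u)"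
  by (intro continuous_at_imp_continuous_on ballI has_derivative_continuous[OF grad_has_derivative])

lemma continuous_hessian: "continuous_on S (\<lambda>x. hessian u x *v v)"
proof -
  have "continuous_on UNIV (\<lambda>x. (hessian u x *v v) \<bullet> b)" for b
    unfolding hessian_inner
    by (rule Ck_imp_continuous[OF Ck_SucD(2)[OF Ck_SucD(2)[OF u_C]]])
  then have "continuous_on UNIV (\<lambda>x. hessian u x *v v)"
    by (subst continuous_on_componentwise) auto
  then show ?thesis using continuous_on_subset by blast
qed

lemma g_has_derivative: "(g has_derivative Dg x) (at x)"
proof -
  have "((\<lambda>y. grad u y v* \<sigma> y) has_derivative
      (\<lambda>v. grad u x v* D\<sigma> x v + (hessian u x *v v) v* \<sigma> x)) (at x)"
    by (rule bounded_bilinear.FDERIV[OF bounded_bilinear_vector_matrix_mult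
          grad_has_derivative \<sigma>_has_derivative])
  then show ?thesis by (simp add: g_def[abs_def] Dg_def[abs_def] add.commute)
qed

lemma linear_Dg: "linear (Dg x)"
  using g_has_derivative has_derivative_linear by blast

lemma S_mat_mult: "S_mat u \<sigma> x *v a = Dg x (\<sigma> x *v a)"
proof -
  have "jacobian g (at x) = matrix (Dg x)"
    unfolding jacobian_def frechet_derivative_at[OF g_has_derivative, symmetric] ..
  then have "jacobian g (at x) *v v = Dg x v" for v
    by (simp add: matrix_works linear_Dg)
  then show ?thesis
    by (simp add: S_mat_def g_def[abs_def, symmetric] matrix_vector_mul_assoc[symmetric])
qed

lemma continuous_\<sigma>_mult: "continuous_on S (\<lambda>x. \<sigma> x *v a)"
  by (rule bounded_bilinear.continuous_on[OF bounded_bilinear_matrix_vector_mult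
        continuous_\<sigma> continuous_on_const])

lemma continuous_S_mat: "continuous_on S (\<lambda>x. S_mat u \<sigma> x *v a)"
proof -
  note vm = bounded_bilinear.continuous_on[OF bounded_bilinear_vector_matrix_mult]
  have "continuous_on S (\<lambda>x. Dg x v)" for v
    unfolding Dg_def
    by (intro continuous_on_add vm continuous_hessian continuous_\<sigma> continuous_grad continuous_D\<sigma>)
  then show ?thesis
    unfolding S_mat_mult
    by (rule continuous_on_linear_family[OF linear_Dg _ continuous_\<sigma>_mult])
qed

text \<open>
  Continuity of the matrix \<open>S\<close>, uniform over controls. It bounds the error of the second-order
  expansion: freezing \<open>S\<close> at \<open>x\<close> costs at most \<open>\<delta> t\<^sup>2\<close> in \<open>u\<close>.
\<close>

lemma S_mat_near:
  assumes "\<delta> > 0"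
  obtains \<rho> where "\<rho> > 0"
    "\<And>z a. z \<in> cball x \<rho> \<Longrightarrow> norm (S_mat u \<sigma> z *v a - S_mat u \<sigma> x *v a) \<le> \<delta> * norm a"
proof -
  define N where "N = (\<lambda>z. \<Sum>b\<in>Basis. norm (S_mat u \<sigma> z *v b - S_mat u \<sigma> x *v b))"
  have "isCont N x"
    unfolding N_def using continuous_S_mat[of UNIV]
    by (intro continuous_intros) (auto simp: continuous_on_eq_continuous_at)
  moreover have "N x = 0" by (simp add: N_def)
  ultimately obtain d where d: "d > 0" "\<And>z. dist z x < d \<Longrightarrow> \<bar>N z\<bar> < \<delta>"
    using assms unfolding continuous_at_eps_delta dist_real_def by auto
  have "norm (S_mat u \<sigma> z *v a - S_mat u \<sigma> x *v a) \<le> \<delta> * norm a" if "z \<in> cball x (d / 2)" for z a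
  proof -
    have "linear (\<lambda>a. S_mat u \<sigma> z *v a - S_mat u \<sigma> x *v a)"
      by (intro linear_compose_sub matrix_vector_mul_linear)
    then have "norm (S_mat u \<sigma> z *v a - S_mat u \<sigma> x *v a) \<le> norm a * N z"
      unfolding N_def by (rule norm_linear_le_sum_Basis)
    also have "\<dots> \<le> norm a * \<delta>"
      using d(2)[of z] that d(1) by (intro mult_left_mono) (auto simp: dist_commute)
    finally show ?thesis by (simp add: mult.commute)
  qed
  then show ?thesis using d(1) that[of "d / 2"] by simp
qed

lemma \<sigma>_mult_has_derivative: "((\<lambda>y. \<sigma> y *v b) has_derivative (\<lambda>v. D\<sigma> x v *v b)) (at x)"
  by (rule bounded_linear.has_derivative[OF
        bounded_bilinear.bounded_linear_left[OF bounded_bilinear_matrix_vector_mult] \<sigma>_has_derivative])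

lemma jacobian_\<sigma>_mult: "jacobian (\<lambda>y. \<sigma> y *v b) (at x) *v v = D\<sigma> x v *v b"
proof -
  have "jacobian (\<lambda>y. \<sigma> y *v b) (at x) = matrix (\<lambda>v. D\<sigma> x v *v b)"
    unfolding jacobian_def frechet_derivative_at[OF \<sigma>_mult_has_derivative, symmetric] ..
  then show ?thesis
    by (simp add: matrix_works has_derivative_linear[OF \<sigma>_mult_has_derivative])
qed

lemma inner_S_mat:
  "b \<bullet> (S_mat u \<sigma> x *v a) = (hessian u x *v (\<sigma> x *v a)) \<bullet> (\<sigma> x *v b) + grad u x \<bullet> (D\<sigma> x (\<sigma> x *v a) *v b)"
  unfolding S_mat_mult Dg_def by (subst inner_commute) (simp add: inner_add_left dot_lmul_matrix)

text \<open>
  The link between conditions (b) and (c). Contracted with \<open>\<nabla>u\<close>, the bracket gives the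
  antisymmetric part \<open>b \<bullet> S a - a \<bullet> S b\<close>, where the terms containing the Hessian cancel by its
  symmetry; the remaining terms give \<open>(a + b) \<bullet> S (a + b)\<close>.
\<close>

lemma second_order_expr_eq:
  "second_order_expr u (\<lambda>x a. \<sigma> x *v a) (\<lambda>a1 a2 x. \<sigma> x *v (a1 + a2)) x a b
     = - two_step_form (S_mat u \<sigma> x) a b"
proof -
  let ?S = "S_mat u \<sigma> x"
  have "second_order_expr u (\<lambda>x a. \<sigma> x *v a) (\<lambda>a1 a2 x. \<sigma> x *v (a1 + a2)) x a b =
      - ((a + b) \<bullet> (?S *v (a + b))) - (D\<sigma> x (\<sigma> x *v a) *v b - D\<sigma> x (\<sigma> x *v b) *v a) \<bullet> grad u x"
    unfolding second_order_expr_def lie_bracket_def trace_mult_outer jacobian_\<sigma>_mult inner_S_mat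
    by (simp add: inner_add_left inner_add_right inner_commute)
  also have "\<dots> = - ((a + b) \<bullet> (?S *v (a + b))) - (b \<bullet> (?S *v a) - a \<bullet> (?S *v b))"
    unfolding inner_S_mat using hessian_symmetric[of x "\<sigma> x *v a" "\<sigma> x *v b"]
    by (simp add: inner_diff_left inner_diff_right inner_commute)
  also have "\<dots> = - two_step_form ?S a b"
    by (simp add: two_step_form_def matrix_vector_right_distrib inner_add_left inner_add_right)
  finally show ?thesis .
qed

end


section \<open>Solutions and their second-order expansion\<close>

lemma norm_diff_le_of_derivative_bound:
  fixes f :: "real \<Rightarrow> 'a::banach"
  assumes "a \<le> b" "finite P" "0 \<le> B"
    and cont: "continuous_on {a..b} f"
    and deriv: "\<And>s. a < s \<Longrightarrow> s < b \<Longrightarrow> s \<notin> P \<Longrightarrow> (f has_vector_derivative f' s) (at s)"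
    and bound: "\<And>s. a < s \<Longrightarrow> s < b \<Longrightarrow> s \<notin> P \<Longrightarrow> norm (f' s) \<le> B"
  shows "norm (f b - f a) \<le> B * (b - a)"
proof -
  have "(f' has_integral (f b - f a)) (cbox a b)"
    using fundamental_theorem_of_calculus_interior_strong[OF \<open>finite P\<close> \<open>a \<le> b\<close> _ cont, of f'] deriv
    by auto
  from has_integral_bound_spike_finite[OF \<open>0 \<le> B\<close> _ this, of "insert a (insert b P)"]
  show ?thesis using bound \<open>finite P\<close> \<open>a \<le> b\<close> by (simp add: less_le)
qed

lemma has_vector_derivative_compose:
  assumes F: "(F has_derivative F') (at (y s))" and y: "(y has_vector_derivative v) (at s)"
  shows "((\<lambda>s. F (y s)) has_vector_derivative F' v) (at s)"
proof -
  have "((\<lambda>s. F (y s)) has_derivative (\<lambda>h. F' (h *\<^sub>R v))) (at s)"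
    using has_derivative_compose[OF y[unfolded has_vector_derivative_def] F] .
  then show ?thesis
    using linear_cmul[OF has_derivative_linear[OF F]] by (simp add: has_vector_derivative_def)
qed

text \<open>
  Picard iteration on the complete space of continuous curves with values in a ball. The
  time bound makes the integral operator map this space into itself and contract it. Curves are
  taken on the whole line, frozen outside \<open>[0, t]\<close>, so that the bounded continuous functions
  provide the complete metric.
\<close>

lemma picard_local_solution:
  fixes h :: "'a::euclidean_space \<Rightarrow> 'a"
  assumes lip: "\<And>x y. x \<in> cball c \<rho> \<Longrightarrow> y \<in> cball c \<rho> \<Longrightarrow> norm (h x - h y) \<le> L * norm (x - y)"
    and bnd: "\<And>x. x \<in> cball c \<rho> \<Longrightarrow> norm (h x) \<le> M"
    and LM: "0 \<le> L" "0 \<le> M" and t: "0 \<le> t" "L * t < 1"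
    and x: "dist c x + M * t \<le> \<rho>"
  obtains y where "y 0 = x" "continuous_on UNIV y"
    "\<And>s. 0 < s \<Longrightarrow> s < t \<Longrightarrow> (y has_vector_derivative h (y s)) (at s)"
    "\<And>s. 0 \<le> s \<Longrightarrow> s \<le> t \<Longrightarrow> y s \<in> cball c \<rho> \<and> norm (y s - x) \<le> M * s"
proof -
  define X where "X = PiC (UNIV :: real set) (\<lambda>_. cball c \<rho>)"
  define cl where "cl s = max 0 (min t s)" for s
  have cl: "0 \<le> cl s" "cl s \<le> t" for s using t(1) by (auto simp: cl_def)
  have cl_cont: "continuous_on UNIV cl"
    unfolding cl_def by (intro continuous_intros)
  define I where "I z s = x + integral {0..cl s} (\<lambda>r. h (apply_bcontfun z r))" for z s
  have "L-lipschitz_on (cball c \<rho>) h"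
    using lip LM(1) by (intro lipschitz_onI) (auto simp: dist_norm)
  then have h_cont: "continuous_on (cball c \<rho>) h" by (rule lipschitz_on_continuous_on)
  have X: "apply_bcontfun z r \<in> cball c \<rho>" if "z \<in> X" for z r
    using that by (auto simp: X_def mem_PiC_iff)
  have hz_cont: "continuous_on S (\<lambda>r. h (apply_bcontfun z r))" if "z \<in> X" for z S
    by (rule continuous_on_compose2[OF h_cont]) (use X[OF that] in auto)
  note hz_int = integrable_continuous_real[OF hz_cont]
  have I_near: "norm (I z s - x) \<le> M * cl s" if "z \<in> X" for z s
  proof -
    have "norm (integral {0..cl s} (\<lambda>r. h (apply_bcontfun z r))) \<le> M * (cl s - 0)"
      by (rule integral_bound) (use cl hz_cont that bnd X in auto)
    then show ?thesis by (simp add: I_def)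
  qed
  have I_ball: "I z s \<in> cball c \<rho>" if "z \<in> X" for z s
  proof -
    have "dist c (I z s) \<le> dist c x + norm (I z s - x)"
      by (metis dist_commute dist_norm dist_triangle)
    also have "\<dots> \<le> dist c x + M * t"
      using I_near[OF that, of s] mult_left_mono[OF cl(2) LM(2), of s] by linarith
    finally show ?thesis using x by simp
  qed
  have I_cont: "continuous_on UNIV (I z)" if "z \<in> X" for z
  proof -
    have "continuous_on {0..t} (\<lambda>s. integral {0..s} (\<lambda>r. h (apply_bcontfun z r)))"
      by (rule indefinite_integral_continuous_1[OF hz_int[OF that]])
    from continuous_on_compose2[OF this cl_cont]
    have "continuous_on UNIV (\<lambda>s. integral {0..cl s} (\<lambda>r. h (apply_bcontfun z r)))"
      using cl by (auto simp: image_subset_iff)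
    then show ?thesis unfolding I_def[abs_def] by (intro continuous_intros)
  qed
  have I_bcont: "I z \<in> bcontfun" if "z \<in> X" for z
    using I_cont[OF that] I_ball[OF that] bounded_subset[OF bounded_cball, of "range (I z)"]
    unfolding bcontfun_def by blast
  define \<Phi> where "\<Phi> z = Bcontfun (I z)" for z
  have \<Phi>: "apply_bcontfun (\<Phi> z) = I z" if "z \<in> X" for z
    unfolding \<Phi>_def by (rule Bcontfun_inverse[OF I_bcont[OF that]])
  have "\<exists>!z\<in>X. \<Phi> z = z"
  proof (rule Banach_fix)
    show "complete X" unfolding X_def complete_eq_closed by (intro closed_PiC closed_cball)
    have "x \<in> cball c \<rho>" using x mult_nonneg_nonneg[OF LM(2) t(1)] by simp
    then have "const_bcontfun x \<in> X"
      by (simp add: X_def mem_PiC_iff const_bcontfun.rep_eq)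
    then show "X \<noteq> {}" by blast
    show "0 \<le> L * t" using LM t by simp
    show "L * t < 1" by fact
    show "\<Phi> ` X \<subseteq> X" using \<Phi> I_ball by (auto simp: X_def mem_PiC_iff)
    fix z w assume zw: "z \<in> X" "w \<in> X"
    show "dist (\<Phi> z) (\<Phi> w) \<le> (L * t) * dist z w"
    proof (rule dist_bound)
      fix s
      have "dist (I z s) (I w s) =
          norm (integral {0..cl s} (\<lambda>r. h (apply_bcontfun z r) - h (apply_bcontfun w r)))"
        by (simp add: I_def dist_norm integral_diff hz_int zw)
      also have "\<dots> \<le> (L * dist z w) * (cl s - 0)"
      proof (rule integral_bound)
        fix r
        have "norm (h (apply_bcontfun z r) - h (apply_bcontfun w r))
            \<le> L * norm (apply_bcontfun z r - apply_bcontfun w r)"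
          by (intro lip X zw)
        also have "\<dots> \<le> L * dist z w"
          using dist_bounded[of z r w] LM(1) by (intro mult_left_mono) (auto simp: dist_norm)
        finally show "norm (h (apply_bcontfun z r) - h (apply_bcontfun w r)) \<le> L * dist z w" .
      qed (auto intro!: continuous_intros hz_cont zw cl)
      also have "\<dots> \<le> (L * dist z w) * t"
        using cl(2)[of s] LM(1) by (intro mult_left_mono) auto
      finally show "dist (apply_bcontfun (\<Phi> z) s) (apply_bcontfun (\<Phi> w) s) \<le> (L * t) * dist z w"
        by (simp add: \<Phi> zw mult_ac)
    qed
  qed
  then obtain z where z: "z \<in> X" "\<Phi> z = z" by blast
  define y where "y = apply_bcontfun z"
  have y: "y s = I z s" for s using \<Phi>[OF z(1)] z(2) by (simp add: y_def)
  show ?thesis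
  proof (rule that)
    show "y 0 = x" using t(1) by (simp add: y I_def cl_def)
    show "continuous_on UNIV y" by (simp add: y_def)
    show "y s \<in> cball c \<rho> \<and> norm (y s - x) \<le> M * s" if "0 \<le> s" "s \<le> t" for s
      using that I_ball[OF z(1), of s] I_near[OF z(1), of s] by (simp add: y cl_def)
    fix s assume s: "0 < s" "s < t"
    have "((\<lambda>s. integral {0..s} (\<lambda>r. h (y r))) has_vector_derivative h (y s)) (at s within {0..t})"
      using s unfolding y_def by (intro integral_has_vector_derivative hz_cont z(1)) auto
    then have "((\<lambda>s. integral {0..s} (\<lambda>r. h (y r))) has_vector_derivative h (y s)) (at s)"
      using s by (simp add: at_within_Icc_at)
    then have deriv: "((\<lambda>s. x + integral {0..s} (\<lambda>r. h (y r))) has_vector_derivative h (y s)) (at s)"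
      by (auto intro!: derivative_eq_intros)
    have eq: "x + integral {0..r} (\<lambda>r. h (y r)) = y r" if "r \<in> {0<..<t}" for r
      unfolding y[of r] I_def using that by (simp add: y_def cl_def)
    show "(y has_vector_derivative h (y s)) (at s)"
      by (rule has_vector_derivative_transform_within_open[OF deriv, of "{0<..<t}"])
        (use s eq in auto)
  qed
qed

text \<open>
  At the first time at which the curve reaches the sphere, its speed was bounded by \<open>M\<close> so far,
  so it cannot have travelled far enough.
\<close>

lemma stays_in_cball:
  fixes y :: "real \<Rightarrow> 'a::banach"
  assumes P: "finite P" and M: "0 \<le> M" and y: "continuous_on {0..t} y"
    and deriv: "\<And>s. 0 < s \<Longrightarrow> s < t \<Longrightarrow> s \<notin> P \<Longrightarrow> (y has_vector_derivative y' s) (at s)"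
    and bound: "\<And>s. 0 < s \<Longrightarrow> s < t \<Longrightarrow> s \<notin> P \<Longrightarrow> y s \<in> cball c R \<Longrightarrow> norm (y' s) \<le> M"
    and start: "dist c (y 0) + M * t < R"
    and s: "0 \<le> s" "s \<le> t"
  shows "y s \<in> cball c R"
proof (rule ccontr)
  assume far: "y s \<notin> cball c R"
  define E where "E = {0..t} \<inter> (\<lambda>r. dist c (y r)) -` {R..}"
  have "closed E"
    unfolding E_def by (intro continuous_closed_preimage continuous_intros y)
  then have "compact E" unfolding E_def by (metis compact_Icc compact_Int_closed inf.left_idem)
  moreover have "E \<noteq> {}" using far s by (auto simp: E_def intro!: exI[of _ s])
  ultimately obtain q where q: "q \<in> E" and first: "\<And>r. r \<in> E \<Longrightarrow> q \<le> r"
    using compact_attains_inf[of E] by blast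
  have q0: "0 \<le> q" "q \<le> t" "R \<le> dist c (y q)" using q by (auto simp: E_def)
  have "norm (y q - y 0) \<le> M * (q - 0)"
  proof (rule norm_diff_le_of_derivative_bound[OF q0(1) P M])
    show "continuous_on {0..q} y" by (rule continuous_on_subset[OF y]) (use q0 in auto)
    fix r assume r: "0 < r" "r < q" "r \<notin> P"
    then show "(y has_vector_derivative y' r) (at r)" using q0 by (intro deriv) auto
    have "r \<notin> E" using first[of r] r by auto
    then show "norm (y' r) \<le> M" using r q0 by (intro bound) (auto simp: E_def)
  qed
  then have "dist c (y q) \<le> dist c (y 0) + M * q"
    using dist_triangle[of c "y q" "y 0"] by (simp add: dist_norm norm_minus_commute)
  moreover have "M * q \<le> M * t" using q0 M by (intro mult_left_mono) auto
  ultimately show False using start q0(3) by linarith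
qed

text \<open>
  The integrated control. It is the variable in which the second-order expansion is expressed.
\<close>

lemma piecewise_constant_has_antiderivative:
  fixes a :: "real \<Rightarrow> 'a::euclidean_space"
  assumes pc: "piecewise_constant a" and B: "\<And>s. 0 \<le> s \<Longrightarrow> norm (a s) \<le> B"
  obtains P A where "finite P" "continuous_on {0..t} A" "A 0 = 0"
    "\<And>s. 0 < s \<Longrightarrow> s < t \<Longrightarrow> s \<notin> P \<Longrightarrow> (A has_vector_derivative a s) (at s)"
proof -
  obtain P where P: "\<And>b. finite (P \<inter> {0..b})"
    and const: "\<And>s r. 0 \<le> s \<Longrightarrow> s \<le> r \<Longrightarrow> P \<inter> {s..r} = {} \<Longrightarrow> a s = a r"
    using pc unfolding piecewise_constant_def by blast
  define Q where "Q = insert 0 (insert t (P \<inter> {0..t}))"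
  define G where "G = {0..t} - Q"
  have Q: "finite Q" using P by (simp add: Q_def)
  have G: "G = {0<..<t} - (P \<inter> {0..t})" by (auto simp: G_def Q_def)
  have G_open: "open G" unfolding G using P[of t] by (intro open_Diff finite_imp_closed) auto
  have a_cont: "isCont a s" if sG: "s \<in> G" for s
  proof -
    obtain e where e: "e > 0" "ball s e \<subseteq> G" using G_open sG by (rule openE)
    have same: "a r = a s" if r: "r \<in> ball s e" for r
    proof -
      (* The control is constant between r and s because no switching time lies between them. *)
      have sub: "{min r s..max r s} \<subseteq> ball s e"
        using r by (auto simp: dist_real_def)
      have "{min r s..max r s} \<subseteq> G" using sub e(2) by (rule subset_trans)
      moreover have "G \<inter> P = {}" "G \<subseteq> {0..}" by (auto simp: G)
      moreover have "min r s \<in> {min r s..max r s}" by simp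
      ultimately have "P \<inter> {min r s..max r s} = {}" "0 \<le> min r s" by blast+
      then have "a (min r s) = a (max r s)" by (intro const) auto
      then show ?thesis by (auto simp: min_def max_def split: if_splits)
    qed
    have "\<forall>\<^sub>F r in at s. a r = a s"
      unfolding eventually_at
      by (rule exI[of _ e]) (auto simp: dist_commute intro!: e(1) same)
    then show ?thesis unfolding isCont_def by (rule tendsto_eventually)
  qed
  have spike: "negligible {s \<in> {0..t} - G. h s \<noteq> 0}" "negligible {s \<in> G - {0..t}. h s \<noteq> 0}"
    for h :: "real \<Rightarrow> 'b::zero"
    by (rule negligible_subset[OF negligible_finite[OF Q]], force simp: G_def)+
  have "a integrable_on G"
  proof (rule measurable_bounded_by_integrable_imp_integrable)
    show "G \<in> sets lebesgue" using G_open by simp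
    then show "a \<in> borel_measurable (lebesgue_on G)"
      using a_cont by (intro continuous_imp_measurable_on_sets_lebesgue continuous_at_imp_continuous_on) auto
    have "(\<lambda>_. B) integrable_on {0..t}" by (rule integrable_const_ivl)
    then show "(\<lambda>_. B) integrable_on G"
      by (rule integrable_spike_set) (rule spike)+
    show "norm (a s) \<le> B" if "s \<in> G" for s using that B by (auto simp: G)
  qed
  then have int: "a integrable_on {0..t}"
    by (rule integrable_spike_set) (rule spike)+
  show ?thesis
  proof (rule that[OF Q])
    show "continuous_on {0..t} (\<lambda>s. integral {0..s} a)" by (rule indefinite_integral_continuous_1[OF int])
    show "integral {0..0} a = 0" by simp
    fix s assume s: "0 < s" "s < t" "s \<notin> Q"
    then have sG: "s \<in> {0..t} - Q" by simp
    have "((\<lambda>s. integral {0..s} a) has_vector_derivative a s) (at s within {0..t} - Q)"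
      using a_cont[of s] sG
      by (intro integral_has_vector_derivative_continuous_at[OF int sG Q])
        (auto simp: G_def intro: continuous_at_imp_continuous_at_within)
    then show "((\<lambda>s. integral {0..s} a) has_vector_derivative a s) (at s)"
      using at_within_open[of s G] G_open sG by (simp add: G_def)
  qed
qed

context symmetric_system
begin

text \<open>
  Let \<open>A\<close> be the integrated control. Since \<open>g\<close> moves with velocity close to \<open>S a\<close>, it stays close
  to \<open>g(x) + S A\<close>; inserting this into \<open>u' = g \<bullet> a\<close> leaves \<open>g(x) \<bullet> a + a \<bullet> S A\<close>. The last term is
  the derivative of \<open>A \<bullet> S A / 2\<close> exactly when \<open>A \<bullet> S a = a \<bullet> S A\<close>, that is, when the antisymmetric
  part of \<open>S\<close> contributes nothing. This covers the two cases used below: symmetric \<open>S\<close> with an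
  arbitrary control, and arbitrary \<open>S\<close> with a constant control.
\<close>

lemma second_order_expansion:
  fixes S :: "real^'m^'m"
  assumes t: "0 \<le> t" and P: "finite P" and \<delta>: "0 \<le> \<delta>"
    and y: "continuous_on {0..t} y"
    and dy: "\<And>s. 0 < s \<Longrightarrow> s < t \<Longrightarrow> s \<notin> P \<Longrightarrow> (y has_vector_derivative \<sigma> (y s) *v a s) (at s)"
    and a: "\<And>s. 0 < s \<Longrightarrow> s < t \<Longrightarrow> norm (a s) \<le> 1"
    and near: "\<And>s b. 0 \<le> s \<Longrightarrow> s \<le> t \<Longrightarrow> norm (S_mat u \<sigma> (y s) *v b - S *v b) \<le> \<delta> * norm b"
    and A: "continuous_on {0..t} A" "A 0 = 0"
    and dA: "\<And>s. 0 < s \<Longrightarrow> s < t \<Longrightarrow> s \<notin> P \<Longrightarrow> (A has_vector_derivative a s) (at s)"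
    and comm: "\<And>s. 0 < s \<Longrightarrow> s < t \<Longrightarrow> s \<notin> P \<Longrightarrow> A s \<bullet> (S *v a s) = a s \<bullet> (S *v A s)"
  shows "norm (g (y t) - g (y 0) - S *v A t) \<le> \<delta> * t"
    and "\<bar>u (y t) - u (y 0) - g (y 0) \<bullet> A t - (A t \<bullet> (S *v A t)) / 2\<bar> \<le> \<delta> * t\<^sup>2"
proof -
  have g_cont: "continuous_on {0..t} (\<lambda>s. g (y s))"
    by (rule continuous_on_compose2[OF _ y, of UNIV])
      (auto intro!: continuous_at_imp_continuous_on has_derivative_continuous[OF g_has_derivative])
  have u_cont: "continuous_on {0..t} (\<lambda>s. u (y s))"
    by (rule continuous_on_compose2[OF _ y, of UNIV])
      (auto intro!: continuous_at_imp_continuous_on has_derivative_continuous[OF u_has_derivative])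
  have SA_cont: "continuous_on {0..t} (\<lambda>s. S *v A s)"
    by (rule bounded_linear.continuous_on[OF matrix_vector_mul_bounded_linear A(1)])
  have dSA: "((\<lambda>s. S *v A s) has_vector_derivative S *v a s) (at s)"
    if "0 < s" "s < t" "s \<notin> P" for s
    by (rule bounded_linear.has_vector_derivative[OF matrix_vector_mul_bounded_linear dA[OF that]])
  have g_est: "norm (g (y r) - g (y 0) - S *v A r) \<le> \<delta> * r" if r: "0 \<le> r" "r \<le> t" for r
  proof -
    have "norm ((g (y r) - S *v A r) - (g (y 0) - S *v A 0)) \<le> \<delta> * (r - 0)"
    proof (rule norm_diff_le_of_derivative_bound[OF r(1) P \<delta>])
      show "continuous_on {0..r} (\<lambda>s. g (y s) - S *v A s)"
        by (rule continuous_on_subset[OF continuous_on_diff[OF g_cont SA_cont]]) (use r in auto)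
      fix s assume "0 < s" "s < r" "s \<notin> P"
      then have s: "0 < s" "s < t" "s \<notin> P" using r by auto
      have "((\<lambda>s. g (y s)) has_vector_derivative S_mat u \<sigma> (y s) *v a s) (at s)"
        unfolding S_mat_mult by (rule has_vector_derivative_compose[OF g_has_derivative dy[OF s]])
      then show "((\<lambda>s. g (y s) - S *v A s) has_vector_derivative
          S_mat u \<sigma> (y s) *v a s - S *v a s) (at s)"
        by (rule has_vector_derivative_diff[OF _ dSA[OF s]])
      have "norm (S_mat u \<sigma> (y s) *v a s - S *v a s) \<le> \<delta> * norm (a s)" using s by (intro near) auto
      also have "\<dots> \<le> \<delta> * 1" using a s \<delta> by (intro mult_left_mono) auto
      finally show "norm (S_mat u \<sigma> (y s) *v a s - S *v a s) \<le> \<delta>" by simp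
    qed
    then show ?thesis by (simp add: A(2) algebra_simps)
  qed
  then show "norm (g (y t) - g (y 0) - S *v A t) \<le> \<delta> * t" using t by simp
  define \<psi> where "\<psi> = (\<lambda>s. u (y s) - g (y 0) \<bullet> A s - (A s \<bullet> (S *v A s)) / 2)"
  define \<psi>' where "\<psi>' = (\<lambda>s. (g (y s) - g (y 0) - S *v A s) \<bullet> a s)"
  have "norm (\<psi> t - \<psi> 0) \<le> (\<delta> * t) * (t - 0)"
  proof (rule norm_diff_le_of_derivative_bound[OF t P])
    show "0 \<le> \<delta> * t" using \<delta> t by simp
    show "continuous_on {0..t} \<psi>"
      unfolding \<psi>_def by (intro continuous_intros u_cont A(1) SA_cont) auto
    fix s assume s: "0 < s" "s < t" "s \<notin> P"
    have "((\<lambda>s. u (y s)) has_vector_derivative g (y s) \<bullet> a s) (at s)"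
      unfolding g_def dot_lmul_matrix
      by (rule has_vector_derivative_compose[OF u_has_derivative dy[OF s]])
    moreover have "((\<lambda>s. g (y 0) \<bullet> A s) has_vector_derivative g (y 0) \<bullet> a s) (at s)"
      by (rule bounded_linear.has_vector_derivative[OF bounded_linear_inner_right dA[OF s]])
    moreover have "((\<lambda>s. (A s \<bullet> (S *v A s)) / 2) has_vector_derivative
        (A s \<bullet> (S *v a s) + a s \<bullet> (S *v A s)) / 2) (at s)"
      by (intro has_vector_derivative_divide
          bounded_bilinear.has_vector_derivative[OF bounded_bilinear_inner] dA[OF s] dSA[OF s])
    ultimately have "(\<psi> has_vector_derivative
        (g (y s) \<bullet> a s - g (y 0) \<bullet> a s - (A s \<bullet> (S *v a s) + a s \<bullet> (S *v A s)) / 2)) (at s)"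
      unfolding \<psi>_def by (intro has_vector_derivative_diff)
    then show "(\<psi> has_vector_derivative \<psi>' s) (at s)"
      using comm[OF s] by (simp add: \<psi>'_def inner_diff_left inner_diff_right inner_commute)
    have "norm (\<psi>' s) \<le> norm (g (y s) - g (y 0) - S *v A s) * norm (a s)"
      unfolding \<psi>'_def real_norm_def by (rule Cauchy_Schwarz_ineq2)
    also have "\<dots> \<le> (\<delta> * s) * 1"
      using s g_est[of s] a[of s] \<delta> by (intro mult_mono) auto
    also have "\<dots> \<le> \<delta> * t" using s \<delta> by (simp add: mult_left_mono)
    finally show "norm (\<psi>' s) \<le> \<delta> * t" .
  qed
  then show "\<bar>u (y t) - u (y 0) - g (y 0) \<bullet> A t - (A t \<bullet> (S *v A t)) / 2\<bar> \<le> \<delta> * t\<^sup>2"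
    by (simp add: \<psi>_def A(2) power2_eq_square algebra_simps)
qed

end


section \<open>Two-arc trajectories and descent\<close>

lemma minimum_time_leI:
  assumes "control A a" "trajectory f a x \<tau> y" "0 \<le> t" "ereal t < \<tau>" "y t \<in> \<T>"
  shows "minimum_time f A \<T> x \<le> ereal t"
proof -
  have "hitting_time f \<T> x a \<le> ereal t"
    unfolding hitting_time_def by (rule Inf_lower) (use assms in blast)
  then show ?thesis
    unfolding minimum_time_def using assms(1) by (intro INF_lower2[of a]) auto
qed

lemma minimum_time_lessE:
  assumes "minimum_time f A \<T> x < ereal c"
  obtains a t \<tau> y where "control A a" "0 \<le> t" "t < c" "solution f a x \<tau> y" "ereal t < \<tau>" "y t \<in> \<T>"
proof -
  obtain a where a: "control A a" "hitting_time f \<T> x a < ereal c"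
    using assms unfolding minimum_time_def INF_less_iff by auto
  then show ?thesis
    unfolding hitting_time_def Inf_less_iff trajectory_def using that by auto
qed

lemma solution_infinite_imp_trajectory: "solution f a x \<infinity> y \<Longrightarrow> trajectory f a x \<infinity> y"
  unfolding trajectory_def by simp

lemma minimum_time_zero_on_target:
  assumes "x \<in> \<T>" "0 \<in> A" "\<And>y. f y 0 = 0"
  shows "minimum_time f A \<T> x \<le> 0"
proof -
  have "control A (\<lambda>_. 0)"
    using assms(2) by (auto simp: control_def piecewise_constant_def)
  moreover have "solution f (\<lambda>_. 0) x \<infinity> (\<lambda>_. x)"
    unfolding solution_def using assms(3) by (auto intro!: exI[of _ "{}"] derivative_eq_intros)
  ultimately show ?thesis
    using minimum_time_leI[OF _ solution_infinite_imp_trajectory order_refl] assms(1)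
    by (fastforce simp: zero_ereal_def)
qed

text \<open>
  After the second arc the control is set to \<open>0\<close> and the curve rests. The concatenated solution is
  therefore defined for all times, which makes it maximal at once.
\<close>

lemma two_arc_trajectory:
  fixes f :: "'x::real_normed_vector \<Rightarrow> 'b::zero \<Rightarrow> 'x"
  assumes t: "0 < t" and rest: "\<And>x. f x 0 = 0" and A: "a1 \<in> A" "a2 \<in> A" "0 \<in> A"
    and y1: "continuous_on UNIV y1" "y1 0 = x"
      "\<And>s. 0 < s \<Longrightarrow> s < t \<Longrightarrow> (y1 has_vector_derivative f (y1 s) a1) (at s)"
    and y2: "continuous_on UNIV y2" "y2 0 = y1 t"
      "\<And>s. 0 < s \<Longrightarrow> s < t \<Longrightarrow> (y2 has_vector_derivative f (y2 s) a2) (at s)"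
  obtains a y where "control A a" "trajectory f a x \<infinity> y" "y (2 * t) = y2 t"
proof -
  define a where "a s = (if s < t then a1 else if s < 2 * t then a2 else 0)" for s
  define z where "z s = y2 (min s (2 * t) - t)" for s
  define y where "y s = (if s \<le> t then y1 s else z s)" for s
  have "control A a"
    unfolding control_def piecewise_constant_def
    using A t by (intro conjI exI[of _ "{t, 2 * t}"]) (auto simp: a_def)
  moreover have "solution f a x \<infinity> y"
    unfolding solution_def
  proof (intro conjI exI[of _ "{t, 2 * t}"] allI impI)
    show "y 0 = x" using t y1(2) by (simp add: y_def)
    have "continuous_on UNIV z"
      unfolding z_def by (rule continuous_on_compose2[OF y2(1)]) (auto intro!: continuous_intros)
    then have "continuous_on ({..t} \<union> {t..}) y"
      unfolding y_def using t y2(2) y1(1)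
      by (intro continuous_on_If) (auto simp: z_def intro: continuous_on_subset)
    then show "continuous_on {s. 0 \<le> s \<and> ereal s < \<infinity>} y"
      by (rule continuous_on_subset) auto
    fix s :: real assume s: "0 < s \<and> ereal s < \<infinity> \<and> s \<notin> {t, 2 * t}"
    then consider "0 < s" "s < t" | "t < s" "s < 2 * t" | "2 * t < s" by fastforce
    then show "(y has_vector_derivative f (y s) (a s)) (at s)"
    proof cases
      case 1
      have "(y has_vector_derivative f (y1 s) a1) (at s)"
        by (rule has_vector_derivative_transform_within_open[OF y1(3)[OF 1], of "{..<t}"])
          (use 1 in \<open>auto simp: y_def\<close>)
      then show ?thesis using 1 by (simp add: y_def a_def)
    next
      case 2
      have shift: "((\<lambda>s. s - t) has_vector_derivative 1) (at s)"
        by (auto intro!: derivative_eq_intros)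
      have "((\<lambda>s. y2 (s - t)) has_vector_derivative 1 *\<^sub>R f (y2 (s - t)) a2) (at s)"
        using vector_diff_chain_at[OF shift, of y2 "f (y2 (s - t)) a2"] y2(3)[of "s - t"] 2
        by (simp add: comp_def)
      from has_vector_derivative_transform_within_open[OF this, of "{t<..<2 * t}" y]
      have "(y has_vector_derivative f (y2 (s - t)) a2) (at s)"
        using 2 by (auto simp: y_def z_def)
      then show ?thesis using 2 by (simp add: y_def z_def a_def)
    next
      case 3
      have "((\<lambda>s. y2 t) has_vector_derivative 0) (at s)" by simp
      from has_vector_derivative_transform_within_open[OF this, of "{2 * t<..}" y]
      have "(y has_vector_derivative 0) (at s)"
        using 3 t by (auto simp: y_def z_def)
      then show ?thesis using 3 t by (simp add: a_def rest)
    qed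
  qed auto
  moreover have "y (2 * t) = y2 t" using t by (simp add: y_def z_def)
  ultimately show ?thesis using that solution_infinite_imp_trajectory by blast
qed

context symmetric_system
begin

abbreviation f where "f \<equiv> \<lambda>x a. \<sigma> x *v a"

lemma field_bounds:
  obtains L M where "0 \<le> L" "0 \<le> M"
    "\<And>x y b. x \<in> cball c R \<Longrightarrow> y \<in> cball c R \<Longrightarrow> norm b \<le> 1 \<Longrightarrow> norm (f x b - f y b) \<le> L * norm (x - y)"
    "\<And>x b. x \<in> cball c R \<Longrightarrow> norm b \<le> 1 \<Longrightarrow> norm (f x b) \<le> M"
proof -
  have "Ck 1 \<sigma>" using Ck_Suc_imp_Ck[of 1 \<sigma>] \<sigma>_C2 by (simp add: numeral_2_eq_2)
  then obtain L where L: "0 \<le> L"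
    "\<And>x y. x \<in> cball c R \<Longrightarrow> y \<in> cball c R \<Longrightarrow> norm (\<sigma> x - \<sigma> y) \<le> L * norm (x - y)"
    using C1_lipschitz_on_cball[of \<sigma> c R] by blast
  have "bounded (\<sigma> ` cball c R)"
    by (intro compact_imp_bounded compact_continuous_image continuous_\<sigma>) auto
  then obtain M where M: "0 < M" "\<And>x. x \<in> cball c R \<Longrightarrow> norm (\<sigma> x) \<le> M"
    unfolding bounded_pos by auto
  obtain K where K: "K > 0"
    "\<And>(B :: real^'m^'n) b. norm (B *v b) \<le> norm B * norm b * K"
    using bounded_bilinear.pos_bounded[OF bounded_bilinear_matrix_vector_mult] by blast
  have K': "norm (B *v b) \<le> norm B * K" if "norm b \<le> 1" for B :: "real^'m^'n" and b
  proof -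
    have "norm B * norm b * K \<le> norm B * 1 * K"
      using that K(1) by (intro mult_right_mono mult_left_mono) auto
    then show ?thesis using K(2)[of B b] by simp
  qed
  show ?thesis
  proof (rule that[of "L * K" "M * K"])
    fix x y b assume xy: "x \<in> cball c R" "y \<in> cball c R" and b: "norm (b :: real^'m) \<le> 1"
    have "norm (f x b - f y b) \<le> norm (\<sigma> x - \<sigma> y) * K"
      using K'[OF b, of "\<sigma> x - \<sigma> y"] by (simp add: matrix_vector_mult_diff_rdistrib)
    also have "\<dots> \<le> L * norm (x - y) * K"
      using L(2)[OF xy] K(1) by (intro mult_right_mono) auto
    finally show "norm (f x b - f y b) \<le> L * K * norm (x - y)" by (simp add: mult_ac)
  next
    fix x b assume x: "x \<in> cball c R" and b: "norm (b :: real^'m) \<le> 1"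
    have "norm (f x b) \<le> norm (\<sigma> x) * K" by (rule K'[OF b])
    also have "\<dots> \<le> M * K" using M(2)[OF x] K(1) by (intro mult_right_mono) auto
    finally show "norm (f x b) \<le> M * K" .
  qed (use L M K in auto)
qed

lemma constant_control_expansion:
  assumes t: "0 \<le> t" and \<delta>: "0 \<le> \<delta>"
    and y: "continuous_on UNIV y"
    and dy: "\<And>s. 0 < s \<Longrightarrow> s < t \<Longrightarrow> (y has_vector_derivative f (y s) b) (at s)"
    and b: "norm b \<le> 1"
    and near: "\<And>s b. 0 \<le> s \<Longrightarrow> s \<le> t \<Longrightarrow> norm (S_mat u \<sigma> (y s) *v b - S *v b) \<le> \<delta> * norm b"
  shows "norm (g (y t) - g (y 0) - t *\<^sub>R (S *v b)) \<le> \<delta> * t"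
    and "\<bar>u (y t) - u (y 0) - t * (g (y 0) \<bullet> b) - t\<^sup>2 * (b \<bullet> (S *v b)) / 2\<bar> \<le> \<delta> * t\<^sup>2"
proof -
  have dA: "((\<lambda>s. s *\<^sub>R b) has_vector_derivative b) (at s)" for s :: real
    by (auto intro!: derivative_eq_intros)
  have cA: "continuous_on {0..t} (\<lambda>s. s *\<^sub>R b)" by (intro continuous_intros)
  have y': "continuous_on {0..t} y" using y continuous_on_subset by blast
  note e = second_order_expansion[OF t finite.emptyI \<delta> y' dy b near cA _ dA]
  show "norm (g (y t) - g (y 0) - t *\<^sub>R (S *v b)) \<le> \<delta> * t"
    using e(1) by (simp add: matrix_vector_mult_scaleR)
  show "\<bar>u (y t) - u (y 0) - t * (g (y 0) \<bullet> b) - t\<^sup>2 * (b \<bullet> (S *v b)) / 2\<bar> \<le> \<delta> * t\<^sup>2"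
    using e(2) by (simp add: matrix_vector_mult_scaleR power2_eq_square)
qed

text \<open>
  The gain \<open>k t\<^sup>2\<close> is uniform near \<open>c\<close>, and \<open>g\<close> may be nonzero at the starting point: the form takes
  the same value at \<open>(a1, a2)\<close> and \<open>(-a1, -a2)\<close>, while the first-order term \<open>t g \<bullet> (a1 + a2)\<close> changes
  sign, so one of the two pairs has a favourable first-order term as well.
\<close>

lemma two_arc_descent:
  fixes c :: "real^'n"
  assumes neg: "two_step_form (S_mat u \<sigma> c) a1 a2 < 0" and a: "norm a1 \<le> 1" "norm a2 \<le> 1"
    and R: "0 < R"
  obtains k t0 \<rho> where "0 < k" "0 < t0" "0 < \<rho>"
    "\<And>x t. x \<in> cball c \<rho> \<Longrightarrow> 0 < t \<Longrightarrow> t \<le> t0 \<Longrightarrow>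
      \<exists>a y. control (cball 0 1) a \<and> trajectory f a x \<infinity> y \<and>
            y (2 * t) \<in> cball c R \<and> u (y (2 * t)) \<le> u x - k * t\<^sup>2"
proof -
  define S where "S = S_mat u \<sigma> c"
  define q where "q = - two_step_form S a1 a2"
  have q: "q > 0" using neg by (simp add: q_def S_def)
  (* The three error terms below, each at most \<delta> t^2, then use up half of the gain q t^2 / 2. *)
  define \<delta> where "\<delta> = q / 12"
  have \<delta>: "0 < \<delta>" using q by (simp add: \<delta>_def)
  obtain \<rho>1 where \<rho>1: "\<rho>1 > 0"
    "\<And>z b. z \<in> cball c \<rho>1 \<Longrightarrow> norm (S_mat u \<sigma> z *v b - S *v b) \<le> \<delta> * norm b"
    using S_mat_near[OF \<delta>, of c] unfolding S_def by blast
  define R' where "R' = min \<rho>1 R"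
  have R': "0 < R'" "R' \<le> \<rho>1" "R' \<le> R" using \<rho>1 R by (auto simp: R'_def)
  obtain L M where L: "0 \<le> L" and M: "0 \<le> M"
    and lip: "\<And>x y b. x \<in> cball c R' \<Longrightarrow> y \<in> cball c R' \<Longrightarrow> norm b \<le> 1 \<Longrightarrow>
      norm (f x b - f y b) \<le> L * norm (x - y)"
    and bnd: "\<And>x b. x \<in> cball c R' \<Longrightarrow> norm b \<le> 1 \<Longrightarrow> norm (f x b) \<le> M"
    using field_bounds[of c R'] by blast
  define t0 where "t0 = min (1 / (2 * (L + 1))) (R' / (4 * (M + 1)))"
  have t0: "0 < t0" using L M R' by (simp add: t0_def)
  have small: "L * t < 1" "2 * (M * t) \<le> R' / 2" if "0 < t" "t \<le> t0" for t
  proof -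
    have "L * t \<le> (L + 1) * (1 / (2 * (L + 1)))"
      using that L by (intro mult_mono) (auto simp: t0_def)
    also have "\<dots> = 1 / 2" using L by simp
    finally show "L * t < 1" by simp
    have "M * t \<le> (M + 1) * (R' / (4 * (M + 1)))"
      using that M R' by (intro mult_mono) (auto simp: t0_def)
    also have "\<dots> = R' / 4" using M by (simp del: distrib_left_numeral)
    finally show "2 * (M * t) \<le> R' / 2" by simp
  qed
  show ?thesis
  proof (rule that[of "q / 4" t0 "R' / 2"])
    fix x t assume x: "x \<in> cball c (R' / 2)" and t: "0 < t" "t \<le> t0"
    note small = small[OF t]
    obtain b1 b2 where b: "norm b1 \<le> 1" "norm b2 \<le> 1" and form: "two_step_form S b1 b2 = - q"
      and downhill: "g x \<bullet> (b1 + b2) \<le> 0"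
    proof (cases "g x \<bullet> (a1 + a2) \<le> 0")
      case True
      then show ?thesis using that[of a1 a2] a by (simp add: q_def)
    next
      case False
      have "two_step_form S (- a1) (- a2) = - q"
        using two_step_form_scaleR[of S "- 1" a1 a2] by (simp add: q_def)
      moreover have "g x \<bullet> (- a1 + - a2) \<le> 0" using False by (simp add: inner_diff_right inner_add_right)
      ultimately show ?thesis using that[of "- a1" "- a2"] a by simp
    qed
    have "dist c x + M * t \<le> R'"
      using x small mult_nonneg_nonneg[OF M less_imp_le[OF t(1)]] unfolding mem_cball by linarith
    then obtain y1 where y1: "y1 0 = x" "continuous_on UNIV y1"
      and dy1: "\<And>s. 0 < s \<Longrightarrow> s < t \<Longrightarrow> (y1 has_vector_derivative f (y1 s) b1) (at s)"
      and y1_in: "\<And>s. 0 \<le> s \<Longrightarrow> s \<le> t \<Longrightarrow> y1 s \<in> cball c R' \<and> norm (y1 s - x) \<le> M * s"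
      using picard_local_solution[of c R' "\<lambda>z. f z b1" L M t x] lip bnd b L M t small by (metis less_imp_le)
    have "dist c (y1 t) \<le> dist c x + M * t"
      using y1_in[of t] t dist_triangle[of c "y1 t" x] by (simp add: dist_norm norm_minus_commute)
    then have "dist c (y1 t) + M * t \<le> R'" using x small by simp
    then obtain y2 where y2: "y2 0 = y1 t" "continuous_on UNIV y2"
      and dy2: "\<And>s. 0 < s \<Longrightarrow> s < t \<Longrightarrow> (y2 has_vector_derivative f (y2 s) b2) (at s)"
      and y2_in: "\<And>s. 0 \<le> s \<Longrightarrow> s \<le> t \<Longrightarrow> y2 s \<in> cball c R' \<and> norm (y2 s - y1 t) \<le> M * s"
      using picard_local_solution[of c R' "\<lambda>z. f z b2" L M t "y1 t"] lip bnd b L M t small by (metis less_imp_le)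
    have sub: "z \<in> cball c \<rho>1" if "z \<in> cball c R'" for z using that R' by simp
    note e1 = constant_control_expansion[OF less_imp_le[OF t(1)] less_imp_le[OF \<delta>] y1(2) dy1 b(1) \<rho>1(2)[OF sub]]
    note e2 = constant_control_expansion[OF less_imp_le[OF t(1)] less_imp_le[OF \<delta>] y2(2) dy2 b(2) \<rho>1(2)[OF sub]]
    have u1: "u (y1 t) \<le> u x + t * (g x \<bullet> b1) + t\<^sup>2 * (b1 \<bullet> (S *v b1)) / 2 + \<delta> * t\<^sup>2"
      using e1(2) y1_in y1(1) by (simp add: abs_le_iff)
    have u2: "u (y2 t) \<le> u (y1 t) + t * (g (y1 t) \<bullet> b2) + t\<^sup>2 * (b2 \<bullet> (S *v b2)) / 2 + \<delta> * t\<^sup>2"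
      using e2(2) y2_in y2(1) by (simp add: abs_le_iff)
    have "(g (y1 t) - g x - t *\<^sub>R (S *v b1)) \<bullet> b2 \<le> norm (g (y1 t) - g x - t *\<^sub>R (S *v b1)) * norm b2"
      by (rule norm_cauchy_schwarz)
    also have "\<dots> \<le> \<delta> * t * 1"
      using e1(1) y1_in y1(1) b(2) \<delta> t by (intro mult_mono) auto
    finally have "g (y1 t) \<bullet> b2 \<le> g x \<bullet> b2 + t * (b2 \<bullet> (S *v b1)) + \<delta> * t"
      by (simp add: inner_diff_left inner_diff_right inner_commute)
    then have g1: "t * (g (y1 t) \<bullet> b2) \<le> t * (g x \<bullet> b2 + t * (b2 \<bullet> (S *v b1)) + \<delta> * t)"
      using t by (intro mult_left_mono) auto
    have "u (y2 t) \<le> u x + t * (g x \<bullet> (b1 + b2)) + t\<^sup>2 * two_step_form S b1 b2 / 2 + 3 * (\<delta> * t\<^sup>2)"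
      using u1 u2 g1 by (simp add: two_step_form_def inner_add_right power2_eq_square field_simps)
    also have "\<dots> \<le> u x + t\<^sup>2 * (- q) / 2 + 3 * (\<delta> * t\<^sup>2)"
      using downhill t form by (simp add: mult_le_0_iff)
    also have "\<dots> = u x - q / 4 * t\<^sup>2" by (simp add: \<delta>_def field_simps)
    finally have drop: "u (y2 t) \<le> u x - q / 4 * t\<^sup>2" .
    obtain a y where "control (cball 0 1) a" "trajectory f a x \<infinity> y" "y (2 * t) = y2 t"
      using two_arc_trajectory[of t f b1 "cball 0 1" b2 y1 x y2] t(1) b y1 y2 dy1 dy2
      by (metis dist_0_norm matrix_vector_mult_0_right mem_cball norm_zero zero_le_one)
    moreover have "y2 t \<in> cball c R" using y2_in[of t] t R' by auto
    ultimately show "\<exists>a y. control (cball 0 1) a \<and> trajectory f a x \<infinity> y \<and>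
        y (2 * t) \<in> cball c R \<and> u (y (2 * t)) \<le> u x - q / 4 * t\<^sup>2"
      using drop by metis
  qed (use q t0 R' in auto)
qed

end


section \<open>Time estimates and the equivalence\<close>

context symmetric_system
begin

text \<open>
  The excess \<open>u(x) - u(c)\<close> is at most a multiple of the distance to the target, and two arcs of
  length \<open>t\<close> remove an excess \<open>k t\<^sup>2\<close>. Choosing \<open>t\<close> so that the whole excess is removed gives the
  square root.
\<close>

lemma infdist_bound_of_negative_form:
  assumes neg: "two_step_form (S_mat u \<sigma> c) a b < 0"
    and target: "open U" "c \<in> U" "\<T> \<inter> U = {x \<in> U. u x \<le> u c}"
  shows "\<exists>C>0. \<exists>r>0. \<forall>x\<in>cball c r.
    minimum_time f (cball 0 1) \<T> x \<le> ereal (C * infdist x \<T> powr (1/2))"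
proof -
  let ?T = "minimum_time f (cball 0 1) \<T>"
  define n where "n = norm a + norm b + 1"
  have n: "n > 0" by (simp add: n_def add_nonneg_pos)
  have neg': "two_step_form (S_mat u \<sigma> c) ((1 / n) *\<^sub>R a) ((1 / n) *\<^sub>R b) < 0"
    unfolding two_step_form_scaleR using neg n by (simp add: mult_pos_neg)
  have unit: "norm ((1 / n) *\<^sub>R a) \<le> 1" "norm ((1 / n) *\<^sub>R b) \<le> 1"
    using n by (simp_all add: n_def add_nonneg_pos)
  obtain R where R: "R > 0" "cball c R \<subseteq> U"
    using target open_contains_cball by blast
  obtain k t0 \<rho> where k: "0 < k" "0 < t0" "0 < \<rho>"
    and descent: "\<And>x t. x \<in> cball c \<rho> \<Longrightarrow> 0 < t \<Longrightarrow> t \<le> t0 \<Longrightarrow>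
      \<exists>a y. control (cball 0 1) a \<and> trajectory f a x \<infinity> y \<and>
            y (2 * t) \<in> cball c R \<and> u (y (2 * t)) \<le> u x - k * t\<^sup>2"
    using two_arc_descent[OF neg' unit R(1)] by blast
  have "Ck 1 u"
    using Ck_Suc_imp_Ck[OF Ck_Suc_imp_Ck[OF u_C]] by simp
  then obtain L0 where L0: "0 \<le> L0"
    "\<And>x y. x \<in> cball c R \<Longrightarrow> y \<in> cball c R \<Longrightarrow> norm (u x - u y) \<le> L0 * norm (x - y)"
    using C1_lipschitz_on_cball[of u c R] by blast
  define L where "L = L0 + 1"
  have L: "L > 0" using L0 by (simp add: L_def)
  have u_lip: "u x - u y \<le> L * dist x y" if "x \<in> cball c R" "y \<in> cball c R" for x y
  proof -
    have "L0 * norm (x - y) \<le> L * norm (x - y)" by (simp add: L_def distrib_right)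
    then show ?thesis using L0(2)[OF that] by (simp add: dist_norm abs_le_iff)
  qed
  define r where "r = min \<rho> (min (R / 3) (k * t0\<^sup>2 / L))"
  have r: "0 < r" "r \<le> \<rho>" "r \<le> R / 3" "L * r \<le> k * t0\<^sup>2"
  proof -
    show "0 < r" using k L R by (simp add: r_def)
    show "r \<le> \<rho>" "r \<le> R / 3" unfolding r_def by linarith+
    have "r \<le> k * t0\<^sup>2 / L" by (simp add: r_def)
    then show "L * r \<le> k * t0\<^sup>2" using L by (simp add: field_simps)
  qed
  have "c \<in> \<T>" using target by auto
  define C where "C = 2 * sqrt (L / k)"
  have "C > 0" using L k by (simp add: C_def)
  moreover have "?T x \<le> ereal (C * infdist x \<T> powr (1/2))" if x: "x \<in> cball c r" for x
  proof (cases "u x \<le> u c")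
    case True
    have "x \<in> U" using x r R by auto
    then have "x \<in> \<T>" using True target(3) by blast
    then have "?T x \<le> 0" by (rule minimum_time_zero_on_target) auto
    also have "0 \<le> ereal (C * infdist x \<T> powr (1/2))" using \<open>C > 0\<close> by simp
    finally show ?thesis .
  next
    case False
    define e where "e = u x - u c"
    have e: "0 < e" using False by (simp add: e_def)
    have xR: "x \<in> cball c R" "c \<in> cball c R" using x r R by auto
    have e_dist: "e \<le> L * dist x c" unfolding e_def by (rule u_lip[OF xR])
    (* The target is described by u only near c. A point of the target outside the ball of radius R
       is farther from x than c itself is, because x is within R / 3 of c. *)
    have "e / L \<le> dist x z" if z: "z \<in> \<T>" for z
    proof (cases "z \<in> cball c R")
      case True
      then have "u z \<le> u c" using z R target(3) by blast
      then have "e \<le> L * dist x z" using u_lip[OF xR(1) True] by (simp add: e_def)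
      then show ?thesis using L by (simp add: field_simps)
    next
      case False
      then have "R \<le> dist c x + dist x z" using dist_triangle[of c z x] by simp
      then have "dist x c \<le> dist x z" using x r by (simp add: dist_commute)
      then have "L * dist x c \<le> L * dist x z" using L by simp
      then have "e \<le> L * dist x z" using e_dist by linarith
      then show ?thesis using L by (simp add: field_simps)
    qed
    then have "e / L \<le> infdist x \<T>"
      using \<open>c \<in> \<T>\<close> by (auto simp: infdist_def intro!: cINF_greatest)
    then have e_inf: "e \<le> L * infdist x \<T>" using L by (simp add: field_simps)
    define t where "t = sqrt (e / k)"
    have t: "0 < t" "t\<^sup>2 = e / k" using e k by (simp_all add: t_def)
    have "e \<le> k * t0\<^sup>2"
    proof -
      have "L * dist x c \<le> L * r" using x L by (simp add: dist_commute)
      then show ?thesis using e_dist r(4) by linarith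
    qed
    then have "t\<^sup>2 \<le> t0\<^sup>2" unfolding t(2) using k by (simp add: field_simps)
    then have "t \<le> t0" using k by (simp add: power2_le_iff_abs_le)
    moreover have "x \<in> cball c \<rho>" using x r by simp
    ultimately obtain a y where a: "control (cball 0 1) a" "trajectory f a x \<infinity> y"
      and y: "y (2 * t) \<in> cball c R" "u (y (2 * t)) \<le> u x - k * t\<^sup>2"
      using descent[of x t] t(1) by blast
    have "u (y (2 * t)) \<le> u c" using y(2) k unfolding t(2) e_def by simp
    then have "y (2 * t) \<in> \<T>" using y(1) R(2) target(3) by blast
    then have "?T x \<le> ereal (2 * t)" using t(1) by (intro minimum_time_leI[OF a]) auto
    also have "2 * t \<le> C * infdist x \<T> powr (1/2)"
    proof -
      have "t \<le> sqrt (L * infdist x \<T> / k)"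
        unfolding t_def using e_inf k by (intro real_sqrt_le_mono divide_right_mono) auto
      also have "\<dots> = sqrt (L / k) * infdist x \<T> powr (1/2)"
        by (simp add: powr_half_sqrt infdist_nonneg real_sqrt_mult real_sqrt_divide)
      finally show ?thesis by (simp add: C_def)
    qed
    finally show ?thesis by simp
  qed
  ultimately show ?thesis using r(1) by blast
qed

text \<open>
  Start at \<open>x\<close> at distance \<open>\<epsilon> = q\<^sup>2\<close> from \<open>c\<close> in the direction of the gradient, where the excess
  \<open>u(x) - u(c)\<close> is of order \<open>\<epsilon>\<close>. The form being nonnegative, \<open>S\<close> is symmetric and positive
  semidefinite, so the second-order term \<open>A \<bullet> S A / 2\<close> never helps. The first-order term is at most
  \<open>|g(x)| t\<close> with \<open>g(x) = O(\<epsilon>)\<close>, because \<open>g\<close> vanishes at \<open>c\<close>. In a time \<open>t = O(\<epsilon>\<^sup>1\<^sup>/\<^sup>2)\<close> it is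
  \<open>O(\<epsilon>\<^sup>3\<^sup>/\<^sup>2)\<close>, and the remainder is \<open>o(t\<^sup>2) = o(\<epsilon>)\<close>: the excess cannot be removed.
\<close>

lemma no_holder_bound_of_nonneg_form:
  assumes nonneg: "\<And>a b. 0 \<le> two_step_form (S_mat u \<sigma> c) a b"
    and grad: "grad u c \<noteq> 0" and crit: "g c = 0"
    and target: "open U" "c \<in> U" "\<T> \<inter> U = {x \<in> U. u x \<le> u c}"
    and C: "0 < C" and r: "0 < r"
    and bound: "\<And>x. x \<in> cball c r \<Longrightarrow>
      minimum_time f (cball 0 1) \<T> x \<le> ereal (C * norm (x - c) powr (1/2))"
  shows False
proof -
  define S where "S = S_mat u \<sigma> c"
  have S_sym: "b \<bullet> (S *v a) = a \<bullet> (S *v b)" and S_psd: "0 \<le> a \<bullet> (S *v a)" for a b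
    using two_step_form_nonneg_imp[of S] nonneg by (simp_all add: S_def)
  define p where "p = norm (grad u c) / 2"
  have p: "p > 0" using grad by (simp add: p_def)
  (* With t < 2 C q this makes the remainder \<delta> t^2 at most half of the initial excess p q^2. *)
  define \<delta> where "\<delta> = p / (8 * C\<^sup>2)"
  have \<delta>: "\<delta> > 0" using p C by (simp add: \<delta>_def)
  obtain \<rho> where \<rho>: "\<rho> > 0"
    "\<And>z b. z \<in> cball c \<rho> \<Longrightarrow> norm (S_mat u \<sigma> z *v b - S *v b) \<le> \<delta> * norm b"
    using S_mat_near[OF \<delta>, of c] unfolding S_def by blast
  obtain R0 where R0: "R0 > 0" "cball c R0 \<subseteq> U"
    using target open_contains_cball by blast
  define R where "R = min \<rho> R0"
  have R: "0 < R" "cball c R \<subseteq> cball c \<rho>" "cball c R \<subseteq> U"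
    using \<rho> R0 by (auto simp: R_def)
  obtain L M where M: "0 \<le> L" "0 \<le> M"
    and "\<And>x y b. x \<in> cball c R \<Longrightarrow> y \<in> cball c R \<Longrightarrow> norm b \<le> 1 \<Longrightarrow>
      norm (f x b - f y b) \<le> L * norm (x - y)"
    and bnd: "\<And>x b. x \<in> cball c R \<Longrightarrow> norm b \<le> 1 \<Longrightarrow> norm (f x b) \<le> M"
    using field_bounds[of c R] by blast
  note M = M(2)
  obtain d1 where d1: "d1 > 0"
    "\<And>x. norm (x - c) < d1 \<Longrightarrow> norm (u x - u c - grad u c \<bullet> (x - c)) \<le> p * norm (x - c)"
    using u_has_derivative[of c, unfolded has_derivative_at_alt, THEN conjunct2, rule_format, OF p]
    by blast
  obtain d2 where d2: "d2 > 0"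
    "\<And>x. norm (x - c) < d2 \<Longrightarrow> norm (g x - g c - Dg c (x - c)) \<le> 1 * norm (x - c)"
    using g_has_derivative[of c, unfolded has_derivative_at_alt, THEN conjunct2, rule_format, OF zero_less_one]
    by blast
  obtain K0 where K0: "K0 > 0" "\<And>v. norm (Dg c v) \<le> norm v * K0"
    using bounded_linear.pos_bounded[OF has_derivative_bounded_linear[OF g_has_derivative]] by blast
  define K where "K = K0 + 1"
  have g_small: "norm (g x) \<le> K * norm (x - c)" if "norm (x - c) < d2" for x
  proof -
    have "norm (g x) \<le> norm (g x - g c - Dg c (x - c)) + norm (Dg c (x - c))"
      using norm_triangle_ineq[of "g x - g c - Dg c (x - c)" "Dg c (x - c)"] crit by simp
    then show ?thesis using d2(2)[OF that] K0(2)[of "x - c"] by (simp add: K_def algebra_simps)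
  qed
  have "\<forall>\<^sub>F q in at_right (0::real). q\<^sup>2 < r \<and> q\<^sup>2 < d1 \<and> q\<^sup>2 < d2 \<and>
      q\<^sup>2 + M * (2 * C * q) < R \<and> K * (2 * C * q) < p / 2"
  proof (intro eventually_conj)
    have sq: "((\<lambda>q. q\<^sup>2) \<longlongrightarrow> (0::real)\<^sup>2) (at_right 0)" by (intro tendsto_intros)
    show "\<forall>\<^sub>F q in at_right (0::real). q\<^sup>2 < r" "\<forall>\<^sub>F q in at_right (0::real). q\<^sup>2 < d1"
      "\<forall>\<^sub>F q in at_right (0::real). q\<^sup>2 < d2"
      using order_tendstoD(2)[OF sq] r d1 d2 by auto
    have "((\<lambda>q. q\<^sup>2 + M * (2 * C * q)) \<longlongrightarrow> (0::real)\<^sup>2 + M * (2 * C * 0)) (at_right 0)"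
      by (intro tendsto_intros)
    from order_tendstoD(2)[OF this] show "\<forall>\<^sub>F q in at_right 0. q\<^sup>2 + M * (2 * C * q) < R"
      using R by simp
    have "((\<lambda>q. K * (2 * C * q)) \<longlongrightarrow> K * (2 * C * 0)) (at_right 0)"
      by (intro tendsto_intros)
    from order_tendstoD(2)[OF this, of "p / 2"]
    show "\<forall>\<^sub>F q in at_right 0. K * (2 * C * q) < p / 2"
      using p by simp
  qed
  moreover have "\<forall>\<^sub>F q in at_right (0::real). 0 < q" by (simp add: eventually_at_right_less)
  ultimately have "\<forall>\<^sub>F q in at_right (0::real). 0 < q \<and> q\<^sup>2 < r \<and> q\<^sup>2 < d1 \<and> q\<^sup>2 < d2 \<and>
      q\<^sup>2 + M * (2 * C * q) < R \<and> K * (2 * C * q) < p / 2"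
    by eventually_elim simp
  then obtain q where q: "0 < q" "q\<^sup>2 < r" "q\<^sup>2 < d1" "q\<^sup>2 < d2"
      "q\<^sup>2 + M * (2 * C * q) < R" "K * (2 * C * q) < p / 2"
    using eventually_happens[of _ "at_right (0::real)"] by (auto simp: trivial_limit_at_right_real)
  (* The assumed bound at this point reads T x \<le> C q, so some trajectory from x reaches the target
     before the time 2 C q. *)
  define x where "x = c + (q\<^sup>2 / norm (grad u c)) *\<^sub>R grad u c"
  have xc: "norm (x - c) = q\<^sup>2" using grad by (simp add: x_def)
  have "grad u c \<bullet> (x - c) = 2 * p * q\<^sup>2"
    using grad by (simp add: x_def p_def power2_norm_eq_inner[symmetric] power2_eq_square)
  then have ux: "u c + p * q\<^sup>2 \<le> u x"
    using d1(2)[of x] q xc by (simp add: abs_le_iff)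
  have "norm (x - c) powr (1/2) = q" using q by (simp add: xc powr_half_sqrt)
  then have "minimum_time f (cball 0 1) \<T> x \<le> ereal (C * q)"
    using bound[of x] xc q by (simp add: dist_norm norm_minus_commute)
  also have "\<dots> < ereal (2 * C * q)" using C q by simp
  finally obtain a t \<tau> y where a: "control (cball 0 1) a" and t: "0 \<le> t" "t < 2 * C * q"
    and sol: "solution f a x \<tau> y" and \<tau>: "ereal t < \<tau>" and hit: "y t \<in> \<T>"
    by (rule minimum_time_lessE) blast
  have na: "norm (a s) \<le> 1" if "0 \<le> s" for s using a that by (auto simp: control_def)
  obtain P where P: "\<And>b. finite (P \<inter> {0..b})"
    and dy: "\<And>s. 0 < s \<Longrightarrow> ereal s < \<tau> \<Longrightarrow> s \<notin> P \<Longrightarrow> (y has_vector_derivative f (y s) (a s)) (at s)"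
    and y0: "y 0 = x" and y_cont: "continuous_on {s. 0 \<le> s \<and> ereal s < \<tau>} y"
    using sol unfolding solution_def by blast
  have before: "ereal s < \<tau>" if "s \<le> t" for s using that \<tau> by (metis ereal_less_eq(3) le_less_trans)
  obtain PA A where PA: "finite PA" and A: "continuous_on {0..t} A" "A 0 = 0"
    and dA: "\<And>s. 0 < s \<Longrightarrow> s < t \<Longrightarrow> s \<notin> PA \<Longrightarrow> (A has_vector_derivative a s) (at s)"
    using piecewise_constant_has_antiderivative[of a 1 t] a na unfolding control_def by metis
  define Q where "Q = P \<inter> {0..t} \<union> PA"
  have Q: "finite Q" using P PA by (simp add: Q_def)
  have dy': "(y has_vector_derivative f (y s) (a s)) (at s)" if "0 < s" "s < t" "s \<notin> Q" for s
    using that dy[of s] before[of s] by (simp add: Q_def)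
  have dA': "(A has_vector_derivative a s) (at s)" if "0 < s" "s < t" "s \<notin> Q" for s
    using that dA by (simp add: Q_def)
  have y_cont': "continuous_on {0..t} y"
    by (rule continuous_on_subset[OF y_cont]) (use before in auto)
  have Mt: "M * t \<le> M * (2 * C * q)" using t M by (intro mult_left_mono) auto
  have y_in: "y s \<in> cball c R" if "0 \<le> s" "s \<le> t" for s
    by (rule stays_in_cball[OF Q M y_cont' dy' _ _ that])
      (use bnd na Mt q xc y0 in \<open>auto simp: dist_norm norm_minus_commute\<close>)
  have "\<bar>u (y t) - u (y 0) - g (y 0) \<bullet> A t - (A t \<bullet> (S *v A t)) / 2\<bar> \<le> \<delta> * t\<^sup>2"
    using \<rho>(2)[OF subsetD[OF R(2) y_in]] na
    by (intro second_order_expansion(2)[OF t(1) Q less_imp_le[OF \<delta>] y_cont' dy' _ _ A dA' S_sym]) auto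
  then have "u x + g x \<bullet> A t - \<delta> * t\<^sup>2 \<le> u (y t)"
    using S_psd[of "A t"] by (simp add: y0 abs_le_iff)
  moreover have "- (p / 2 * q\<^sup>2) < g x \<bullet> A t"
  proof -
    have "norm (A t - A 0) \<le> 1 * (t - 0)"
      by (rule norm_diff_le_of_derivative_bound[OF t(1) Q _ A(1) dA']) (use na in auto)
    then have "norm (A t) \<le> 2 * C * q" using t A(2) by simp
    moreover have "norm (g x) \<le> K * q\<^sup>2" using g_small[of x] xc q by simp
    ultimately have "norm (g x) * norm (A t) \<le> (K * q\<^sup>2) * (2 * C * q)"
      using K0 by (intro mult_mono) (auto simp: K_def)
    also have "\<dots> = (K * (2 * C * q)) * q\<^sup>2" by simp
    also have "\<dots> < p / 2 * q\<^sup>2" using q by (intro mult_strict_right_mono) auto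
    finally show ?thesis using Cauchy_Schwarz_ineq2[of "g x" "A t"] by linarith
  qed
  moreover have "\<delta> * t\<^sup>2 \<le> p / 2 * q\<^sup>2"
  proof -
    have "t\<^sup>2 \<le> (2 * C * q)\<^sup>2" using t by (intro power_mono) auto
    then have "\<delta> * t\<^sup>2 \<le> \<delta> * (2 * C * q)\<^sup>2" using \<delta> by (intro mult_left_mono) auto
    also have "\<dots> = p / 2 * q\<^sup>2" using C by (simp add: \<delta>_def power2_eq_square)
    finally show ?thesis .
  qed
  ultimately have "u c < u (y t)" using ux by (simp add: algebra_simps)
  moreover have "y t \<in> U" using y_in[of t] t R(3) by auto
  ultimately show False using hit target(3) by force
qed

text \<open>
  The form is continuous on the compact product of unit balls, so the maximum exists, and it is
  homogeneous of degree two, so restricting the controls to unit balls does not affect its sign.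
\<close>

lemma positive_maximum_iff_negative_form:
  "(\<exists>M>0. is_maximum M (\<lambda>(a1, a2). second_order_expr u f (\<lambda>a1 a2 x. \<sigma> x *v (a1 + a2)) c a1 a2)
       (cball 0 1 \<times> cball 0 1)) \<longleftrightarrow>
   (\<exists>a b. two_step_form (S_mat u \<sigma> c) a b < 0)"
proof
  assume "\<exists>M>0. is_maximum M (\<lambda>(a1, a2). second_order_expr u f (\<lambda>a1 a2 x. \<sigma> x *v (a1 + a2)) c a1 a2)
       (cball 0 1 \<times> cball 0 1)"
  then show "\<exists>a b. two_step_form (S_mat u \<sigma> c) a b < 0"
    unfolding is_maximum_def second_order_expr_eq by force
next
  assume "\<exists>a b. two_step_form (S_mat u \<sigma> c) a b < 0"
  then obtain a b where ab: "two_step_form (S_mat u \<sigma> c) a b < 0" by blast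
  define h where "h = (\<lambda>(a, b). - two_step_form (S_mat u \<sigma> c) a b)"
  define B where "B = cball (0::real^'m) 1 \<times> cball (0::real^'m) 1"
  have "continuous_on B h"
    unfolding h_def two_step_form_def case_prod_unfold
    by (intro continuous_intros bounded_linear.continuous_on[OF matrix_vector_mul_bounded_linear])
  moreover have "compact B" "B \<noteq> {}" by (simp_all add: B_def compact_Times)
  ultimately obtain m where m: "m \<in> B" "\<And>p. p \<in> B \<Longrightarrow> h p \<le> h m"
    using continuous_attains_sup[of B h] by blast
  define n where "n = norm a + norm b + 1"
  have n: "n > 0" by (simp add: n_def add_nonneg_pos)
  have "((1 / n) *\<^sub>R a, (1 / n) *\<^sub>R b) \<in> B"
    using n by (simp add: B_def n_def add_nonneg_pos)
  from m(2)[OF this] have "- ((1 / n)\<^sup>2 * two_step_form (S_mat u \<sigma> c) a b) \<le> h m"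
    unfolding h_def two_step_form_scaleR[symmetric] by simp
  moreover have "(1 / n)\<^sup>2 * two_step_form (S_mat u \<sigma> c) a b < 0" using n ab by (intro mult_pos_neg) auto
  ultimately have "0 < h m" by linarith
  moreover have "is_maximum (h m) h B" using m by (auto simp: is_maximum_def)
  ultimately show "\<exists>M>0. is_maximum M
      (\<lambda>(a1, a2). second_order_expr u f (\<lambda>a1 a2 x. \<sigma> x *v (a1 + a2)) c a1 a2) (cball 0 1 \<times> cball 0 1)"
    unfolding second_order_expr_eq h_def B_def by blast
qed

end

theorem proposition4p7:
  fixes \<sigma> :: "real^'n \<Rightarrow> real^'m^'n"
    and u :: "real^'n \<Rightarrow> real"
    and xbar :: "real^'n"
    and \<T> U :: "(real^'n) set"
    and f :: "real^'n \<Rightarrow> real^'m \<Rightarrow> real^'n"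
    and F :: "real^'m \<Rightarrow> real^'m \<Rightarrow> real^'n \<Rightarrow> real^'n"
    and T :: "real^'n \<Rightarrow> ereal"
  assumes \<sigma>_C2: "Ck 2 \<sigma>"
    and u_C3: "Ck 3 u"
    and grad_nonzero: "grad u xbar \<noteq> 0"
    and grad_\<sigma>_zero: "grad u xbar v* \<sigma> xbar = 0"
    and target: "open U" "xbar \<in> U" "\<T> \<inter> U = {x \<in> U. u x \<le> u xbar}"
  defines "f \<equiv> \<lambda>x a. \<sigma> x *v a"
    and "F \<equiv> \<lambda>a1 a2 x. \<sigma> x *v (a1 + a2)"
    and "T \<equiv> minimum_time f (cball 0 1) \<T>"
  defines "condA \<equiv> \<exists>C>0. \<exists>r>0. \<forall>x\<in>cball xbar r. T x \<le> ereal (C * norm (x - xbar) powr (1/2))"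
    and "condB \<equiv> \<exists>l<0. is_eigenvalue (K_mat u \<sigma> xbar) l"
    and "condC \<equiv> \<exists>M>0. is_maximum M (\<lambda>(a1, a2). second_order_expr u f F xbar a1 a2)
                         (cball 0 1 \<times> cball 0 1)"
  shows "(condA \<longleftrightarrow> condB) \<and> (condB \<longleftrightarrow> condC) \<and>
         (condA \<longrightarrow> (\<exists>C>0. \<exists>r>0. \<forall>x\<in>cball xbar r. T x \<le> ereal (C * infdist x \<T> powr (1/2))))"
proof -
  interpret symmetric_system \<sigma> u by unfold_locales (fact \<sigma>_C2 u_C3)+
  define neg where "neg \<longleftrightarrow> (\<exists>a b. two_step_form (S_mat u \<sigma> xbar) a b < 0)"
  have B: "condB \<longleftrightarrow> neg"
    unfolding condB_def neg_def by (rule K_mat_negative_eigenvalue_iff)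
  have C: "condC \<longleftrightarrow> neg"
    unfolding condC_def neg_def f_def F_def by (rule positive_maximum_iff_negative_form)
  let ?D = "\<exists>C>0. \<exists>r>0. \<forall>x\<in>cball xbar r. T x \<le> ereal (C * infdist x \<T> powr (1/2))"
  have suff: ?D if neg
    using that infdist_bound_of_negative_form[OF _ target] unfolding neg_def T_def f_def by blast
  have "condA" if ?D
  proof -
    have "xbar \<in> \<T>" using target by auto
    then have "C * infdist x \<T> powr (1/2) \<le> C * norm (x - xbar) powr (1/2)" if "C > 0" for C x
      using that infdist_le[of xbar \<T> x] infdist_nonneg[of x \<T>]
      by (intro mult_left_mono powr_mono2) (auto simp: dist_norm)
    then show ?thesis using \<open>?D\<close> unfolding condA_def by (meson ereal_less_eq(3) order_trans)
  qed
  moreover have neg if condA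
  proof (rule ccontr)
    assume "\<not> neg"
    then have nonneg: "0 \<le> two_step_form (S_mat u \<sigma> xbar) a b" for a b
      unfolding neg_def by (meson not_less)
    obtain C r where "C > 0" "r > 0"
      "\<And>x. x \<in> cball xbar r \<Longrightarrow> T x \<le> ereal (C * norm (x - xbar) powr (1/2))"
      using \<open>condA\<close> unfolding condA_def by blast
    then show False
      using no_holder_bound_of_nonneg_form[OF nonneg grad_nonzero _ target] grad_\<sigma>_zero
      unfolding T_def f_def g_def by blast
  qed
  ultimately show ?thesis using B C suff by blast
qed

end
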